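(* For every natural number $n$, ordinal $\alpha$ and shallow sequent $\Gamma$: if $\mathsf{G_C}\vdash^{\alpha}_{\omega\cdot n}\Gamma$ then $\mathsf{G_C}\vdash^{\omega\cdot(\varphi_1^n(\omega\cdot\alpha)+1)}_{0}\Gamma$.
   Context: Fix $h\ge1$ agents. Formulas: $A::=p\mid\bar p\mid A\vee A\mid A\wedge A\mid\Diamond_iA\mid\Box_iA\mid\widetilde{\mathsf C}A\mid\mathsf CA$ ($1\le i\le h$), $\widetilde{\mathsf C}$ the De Morgan dual of $\mathsf C$ (common knowledge); $\bar A$ by De Morgan laws. $\Box A:=\Box_1A\wedge\dots\wedge\Box_hA$, $\Diamond A:=\Diamond_1A\vee\dots\vee\Diamond_hA$, $\Box^k$ iteration. Rank: $rk(p)=rk(\bar p)=0$, $rk(A\wedge B)=rk(A\vee B)=\max(rk A,rk B)+1$, $rk(\Box_iA)=rk(\Diamond_iA)=rk(A)+1$, $rk(\mathsf CA)=rk(\widetilde{\mathsf C}A)=\omega+rk(A)$. A shallow sequent is a finite multiset of formulas; $\Diamond_i\Gamma$, $\widetilde{\mathsf C}\Gamma$ prefix the connective to every element. System $\mathsf{G_C}$ (premises / conclusion): axiom $\Gamma,p,\bar p$; $\wedge$: $\Gamma,A$ and $\Gamma,B$ / $\Gamma,A\wedge B$; $\vee$: $\Gamma,A,B/\Gamma,A\vee B$; $\Box_i$: $\Gamma,\widetilde{\mathsf C}\Delta,A\,/\,\Diamond_i\Gamma,\widetilde{\mathsf C}\Delta,\Box_iA,\Sigma$; $\mathsf C$: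 premises $\Gamma,\Box^kA$ for all $k\ge1$ / $\Gamma,\mathsf CA$; $\widetilde{\mathsf C}$: $\Gamma,\widetilde{\mathsf C}A,\Diamond A/\Gamma,\widetilde{\mathsf C}A$. Cut: $\Gamma,A$ and $\Delta,\bar A$ / $\Gamma,\Delta$, cut rank $rk(A)$. Proofs: well-founded, possibly infinitely branching trees with axiom leaves; depth = least ordinal greater than depths of immediate subproofs. $\mathsf{G_C}\vdash^\alpha_\gamma\Gamma$: a proof of $\Gamma$ in $\mathsf{G_C}$ plus cuts of rank $<\gamma$, of depth $\le\alpha$. Veblen function: $\varphi_0\beta=\omega^\beta$; for $\alpha>0$, $\varphi_\alpha\beta$ is the $(\beta+1)$-th common fixpoint of $\xi\mapsto\varphi_\gamma\xi$ for all $\gamma<\alpha$. $\varphi_1^n$ is the $n$-fold iteration of $\xi\mapsto\varphi_1\xi$. *)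

theory Defs
  imports Main "HOL-Library.Multiset"
begin

section \<open>Ordinals\<close>

text \<open>
  An ordinal is the order type of a well-order on a subset of \<open>'a + nat\<close>. These are exactly the
  ordinals of cardinality at most \<open>max (card 'a) \<aleph>\<^sub>0\<close>, i.e. all ordinals below an uncountable
  regular cardinal. So every family of ordinals indexed by \<open>'a + nat\<close> has a strict upper bound,
  and the type is closed under all the operations below, whose \<open>LEAST\<close> therefore always exists.
  As \<open>'a\<close> is arbitrary, every well-order of HOL has its order type in some instance.
\<close>

quotient_type 'a ordinal = "('a + nat) rel" /
  partial: "\<lambda>r s. Well_order r \<and> Well_order s \<and> (r, s) \<in> ordIso"
proof (rule part_equivpI)
  show "\<exists>r :: ('a + nat) rel. Well_order r \<and> Well_order r \<and> (r, r) \<in> ordIso"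
    using ordIso_reflexive[of "{}"] by (intro exI[of _ "{}"]) simp
  show "symp (\<lambda>r s :: ('a + nat) rel. Well_order r \<and> Well_order s \<and> (r, s) \<in> ordIso)"
    by (auto intro!: sympI ordIso_symmetric)
  show "transp (\<lambda>r s :: ('a + nat) rel. Well_order r \<and> Well_order s \<and> (r, s) \<in> ordIso)"
    by (auto intro!: transpI intro: ordIso_transitive)
qed

instantiation ordinal :: (type) wellorder
begin

lift_definition less_eq_ordinal :: "'a ordinal \<Rightarrow> 'a ordinal \<Rightarrow> bool"
  is "\<lambda>r s. (r, s) \<in> ordLeq"
  by (meson ordIso_ordLeq_trans ordIso_symmetric ordLeq_ordIso_trans)

lift_definition less_ordinal :: "'a ordinal \<Rightarrow> 'a ordinal \<Rightarrow> bool"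
  is "\<lambda>r s. (r, s) \<in> ordLess"
  by (meson ordIso_ordLess_trans ordIso_symmetric ordLess_ordIso_trans)

instance
proof
  fix x y z :: "'a ordinal"
  show "x < y \<longleftrightarrow> x \<le> y \<and> \<not> y \<le> x"
    by transfer (meson not_ordLess_ordLeq ordLess_imp_ordLeq ordLess_or_ordLeq)
  show "x \<le> x"
    by transfer (blast intro: ordLeq_reflexive)
  show "x \<le> z" if "x \<le> y" "y \<le> z"
    using that by transfer (blast intro: ordLeq_transitive)
  show "x = y" if "x \<le> y" "y \<le> x"
    using that by transfer (auto simp: ordIso_iff_ordLeq)
  show "x \<le> y \<or> y \<le> x"
    by transfer (elim conjE, rule ordLeq_total)
next
  fix P :: "'a ordinal \<Rightarrow> bool" and a :: "'a ordinal"
  assume step: "\<And>x. (\<And>y. y < x \<Longrightarrow> P y) \<Longrightarrow> P x"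
  have "Well_order r \<Longrightarrow> P (abs_ordinal r)" for r :: "('a + nat) rel"
  proof (induction r rule: wf_induct_rule[OF wf_ordLess])
    case (1 r)
    show ?case
    proof (rule step)
      fix y assume "y < abs_ordinal r"
      moreover obtain s where s: "y = abs_ordinal s" "Well_order s"
        by (induct y rule: ordinal.abs_induct) blast
      ultimately have "(s, r) \<in> ordLess"
        using 1(2) by (simp add: less_ordinal.abs_eq ordIso_reflexive)
      then show "P y" using 1(1) s by blast
    qed
  qed
  then show "P a"
    by (induct a rule: ordinal.abs_induct) blast
qed

end

text \<open>
  The arithmetic operations are given by recursion on the second argument, with the clauses for
  \<open>0\<close>, successors and limits merged into a single supremum.
\<close>

instantiation ordinal :: (type) "{zero, one, plus, times}"
begin

definition zero_ordinal :: "'a ordinal" where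
  "zero_ordinal = (LEAST \<gamma>. True)"

definition one_ordinal :: "'a ordinal" where
  "one_ordinal = (LEAST \<gamma>. 0 < \<gamma>)"

function plus_ordinal :: "'a ordinal \<Rightarrow> 'a ordinal \<Rightarrow> 'a ordinal" where
  "plus_ordinal \<alpha> \<beta> = (LEAST \<gamma>. \<alpha> \<le> \<gamma> \<and> (\<forall>\<delta>\<in>{..<\<beta>}. plus_ordinal \<alpha> \<delta> < \<gamma>))"
  by auto
termination
  by (relation "inv_image {(x, y). x < y} snd") (auto intro: wf)

declare plus_ordinal.simps [simp del]

function times_ordinal :: "'a ordinal \<Rightarrow> 'a ordinal \<Rightarrow> 'a ordinal" where
  "times_ordinal \<alpha> \<beta> = (LEAST \<gamma>. \<forall>\<delta>\<in>{..<\<beta>}. times_ordinal \<alpha> \<delta> + \<alpha> \<le> \<gamma>)"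
  by auto
termination
  by (relation "inv_image {(x, y). x < y} snd") (auto intro: wf)

declare times_ordinal.simps [simp del]

instance ..

end

primrec ord_of_nat :: "nat \<Rightarrow> 'a ordinal" where
  "ord_of_nat 0 = 0"
| "ord_of_nat (Suc n) = ord_of_nat n + 1"

definition omega :: "'a ordinal" where
  "omega = (LEAST \<gamma>. \<forall>n. ord_of_nat n < \<gamma>)"

function omega_power :: "'a ordinal \<Rightarrow> 'a ordinal" where
  "omega_power \<beta> = (LEAST \<gamma>. 1 \<le> \<gamma> \<and> (\<forall>\<delta>\<in>{..<\<beta>}. omega_power \<delta> * omega \<le> \<gamma>))"
  by auto
termination
  by (relation "{(x, y). x < y}") (auto intro: wf)

declare omega_power.simps [simp del]

text \<open>\<open>enum_ord X \<beta>\<close> is the \<open>(\<beta> + 1)\<close>-th element of the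
  unbounded class \<open>X\<close>; so \<open>enum_ord X 0\<close> is the first.\<close>

function enum_ord :: "'a ordinal set \<Rightarrow> 'a ordinal \<Rightarrow> 'a ordinal" where
  "enum_ord X \<beta> = (LEAST \<xi>. \<xi> \<in> X \<and> (\<forall>\<delta>\<in>{..<\<beta>}. enum_ord X \<delta> < \<xi>))"
  by auto
termination
  by (relation "inv_image {(x, y). x < y} snd") (auto intro: wf)

declare enum_ord.simps [simp del]

function veblen :: "'a ordinal \<Rightarrow> 'a ordinal \<Rightarrow> 'a ordinal" where
  "veblen \<alpha> =
    (if \<alpha> = 0 then omega_power
     else enum_ord {\<xi>. \<forall>\<gamma>\<in>{..<\<alpha>}. veblen \<gamma> \<xi> = \<xi>})"
  by auto
termination
  by (relation "{(x, y). x < y}") (auto intro: wf)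

declare veblen.simps [simp del]


section \<open>Formulas\<close>

text \<open>
  The agents \<open>1, \<dots>, h\<close> are the elements, in increasing order, of a finite linearly ordered type \<open>'i\<close>;
  thus \<open>h = CARD('i) \<ge> 1\<close>. Propositional variables are taken from an arbitrary type \<open>'p\<close>.
  \<open>CK\<close> is common knowledge and \<open>CKd\<close> its De Morgan dual.
\<close>

datatype ('p, 'i) form =
    Pos 'p
  | Neg 'p
  | Or "('p, 'i) form" "('p, 'i) form"
  | And "('p, 'i) form" "('p, 'i) form"
  | Dia 'i "('p, 'i) form"
  | Box 'i "('p, 'i) form"
  | CKd "('p, 'i) form"
  | CK "('p, 'i) form"

primrec dual :: "('p, 'i) form \<Rightarrow> ('p, 'i) form" where
  "dual (Pos p) = Neg p"
| "dual (Neg p) = Pos p"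
| "dual (Or A B) = And (dual A) (dual B)"
| "dual (And A B) = Or (dual A) (dual B)"
| "dual (Dia i A) = Box i (dual A)"
| "dual (Box i A) = Dia i (dual A)"
| "dual (CKd A) = CK (dual A)"
| "dual (CK A) = CKd (dual A)"

text \<open>Iterated connectives associate to the left; the empty list does not occur.\<close>

definition big :: "('f \<Rightarrow> 'f \<Rightarrow> 'f) \<Rightarrow> 'f list \<Rightarrow> 'f" where
  "big con As = foldl con (hd As) (tl As)"

definition agents :: "'i::{finite, linorder} list" where
  "agents = sorted_list_of_set UNIV"

definition box_all :: "('p, 'i::{finite, linorder}) form \<Rightarrow> ('p, 'i) form" where
  "box_all A = big And (map (\<lambda>i. Box i A) agents)"

definition dia_all :: "('p, 'i::{finite, linorder}) form \<Rightarrow> ('p, 'i) form" where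
  "dia_all A = big Or (map (\<lambda>i. Dia i A) agents)"

primrec rk :: "('p, 'i) form \<Rightarrow> 'a ordinal" where
  "rk (Pos p) = 0"
| "rk (Neg p) = 0"
| "rk (Or A B) = max (rk A) (rk B) + 1"
| "rk (And A B) = max (rk A) (rk B) + 1"
| "rk (Dia i A) = rk A + 1"
| "rk (Box i A) = rk A + 1"
| "rk (CKd A) = omega + rk A"
| "rk (CK A) = omega + rk A"


section \<open>The system \<open>G\<^sub>C\<close>\<close>

type_synonym ('p, 'i) sequent = "('p, 'i) form multiset"

text \<open>
  Inferences, grouped by their number of premises; the premises come first. Only \<open>cut_inf\<close> depends
  on the bound \<open>\<gamma>\<close>.
\<close>

inductive axiom_inf :: "('p, 'i) sequent \<Rightarrow> bool" where
  "axiom_inf (\<Gamma> + {#Pos p, Neg p#})"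

inductive unary_inf ::
    "('p, 'i::{finite, linorder}) sequent \<Rightarrow> ('p, 'i) sequent \<Rightarrow> bool" where
  or_inf: "unary_inf (\<Gamma> + {#A, B#}) (\<Gamma> + {#Or A B#})"
| box_inf: "unary_inf (\<Gamma> + image_mset CKd \<Delta> + {#A#})
    (image_mset (Dia i) \<Gamma> + image_mset CKd \<Delta> + {#Box i A#} + \<Sigma>)"
| CKd_inf: "unary_inf (\<Gamma> + {#CKd A, dia_all A#}) (\<Gamma> + {#CKd A#})"

inductive and_inf ::
    "('p, 'i) sequent \<Rightarrow> ('p, 'i) sequent \<Rightarrow> ('p, 'i) sequent \<Rightarrow> bool" where
  "and_inf (\<Gamma> + {#A#}) (\<Gamma> + {#B#}) (\<Gamma> + {#And A B#})"

inductive cut_inf ::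
    "'a ordinal \<Rightarrow> ('p, 'i) sequent \<Rightarrow> ('p, 'i) sequent \<Rightarrow> ('p, 'i) sequent \<Rightarrow> bool"
  for \<gamma> :: "'a ordinal" where
  "rk A < \<gamma> \<Longrightarrow> cut_inf \<gamma> (\<Gamma> + {#A#}) (\<Delta> + {#dual A#}) (\<Gamma> + \<Delta>)"

text \<open>The premise with index \<open>k\<close> is the one for the iteration number \<open>k + 1\<close>.\<close>

inductive CK_inf ::
    "(nat \<Rightarrow> ('p, 'i::{finite, linorder}) sequent) \<Rightarrow> ('p, 'i) sequent \<Rightarrow> bool" where
  "CK_inf (\<lambda>k. \<Gamma> + {#(box_all ^^ Suc k) A#}) (\<Gamma> + {#CK A#})"

text \<open>Being elements of a datatype, the trees are well-founded.\<close>

datatype ('p, 'i) tree =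
    Leaf "('p, 'i) sequent"
  | Unary "('p, 'i) sequent" "('p, 'i) tree"
  | Binary "('p, 'i) sequent" "('p, 'i) tree" "('p, 'i) tree"
  | Infinitary "('p, 'i) sequent" "nat \<Rightarrow> ('p, 'i) tree"

primrec concl :: "('p, 'i) tree \<Rightarrow> ('p, 'i) sequent" where
  "concl (Leaf \<Gamma>) = \<Gamma>"
| "concl (Unary \<Gamma> \<pi>) = \<Gamma>"
| "concl (Binary \<Gamma> \<pi> \<rho>) = \<Gamma>"
| "concl (Infinitary \<Gamma> f) = \<Gamma>"

primrec depth :: "('p, 'i) tree \<Rightarrow> 'a ordinal" where
  "depth (Leaf \<Gamma>) = 0"
| "depth (Unary \<Gamma> \<pi>) = (LEAST \<delta>. depth \<pi> < \<delta>)"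
| "depth (Binary \<Gamma> \<pi> \<rho>) = (LEAST \<delta>. depth \<pi> < \<delta> \<and> depth \<rho> < \<delta>)"
| "depth (Infinitary \<Gamma> f) = (LEAST \<delta>. \<forall>k. depth (f k) < \<delta>)"

primrec is_proof :: "'a ordinal \<Rightarrow> ('p, 'i::{finite, linorder}) tree \<Rightarrow> bool" where
  "is_proof \<gamma> (Leaf \<Gamma>) \<longleftrightarrow> axiom_inf \<Gamma>"
| "is_proof \<gamma> (Unary \<Gamma> \<pi>) \<longleftrightarrow> unary_inf (concl \<pi>) \<Gamma> \<and> is_proof \<gamma> \<pi>"
| "is_proof \<gamma> (Binary \<Gamma> \<pi> \<rho>) \<longleftrightarrow>
    (and_inf (concl \<pi>) (concl \<rho>) \<Gamma> \<or> cut_inf \<gamma> (concl \<pi>) (concl \<rho>) \<Gamma>) \<and>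
    is_proof \<gamma> \<pi> \<and> is_proof \<gamma> \<rho>"
| "is_proof \<gamma> (Infinitary \<Gamma> f) \<longleftrightarrow> CK_inf (\<lambda>k. concl (f k)) \<Gamma> \<and> (\<forall>k. is_proof \<gamma> (f k))"

text \<open>
  \<open>GC_derivable \<alpha> \<gamma> \<Gamma>\<close>: there is a proof of \<open>\<Gamma>\<close> of depth at most \<open>\<alpha>\<close> all of whose cuts have
  rank below \<open>\<gamma>\<close>.
\<close>

definition GC_derivable ::
    "'a ordinal \<Rightarrow> 'a ordinal \<Rightarrow> ('p, 'i::{finite, linorder}) sequent \<Rightarrow> bool" where
  "GC_derivable \<alpha> \<gamma> \<Gamma> \<longleftrightarrow> (\<exists>\<pi>. is_proof \<gamma> \<pi> \<and> concl \<pi> = \<Gamma> \<and> depth \<pi> \<le> \<alpha>)"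

end

theory Submission
  imports Defs
begin

text \<open>
  Cuts are eliminated semantically. For \<open>n = 0\<close> there is nothing to eliminate. For \<open>n > 0\<close> the bound
  is at least \<open>\<omega> \<cdot> \<omega>\<close>, since every fixpoint of \<open>\<xi> \<mapsto> \<omega>\<^sup>\<xi>\<close> is at least \<open>\<omega>\<close>. As the system with cut
  is sound for Kripke models, it suffices to derive every valid sequent without cut with depth
  \<open>\<omega> \<cdot> m\<close> for some natural number \<open>m\<close>.

  The finitely many subsets of the closure of the sequent allow to choose \<open>m\<close> such that a subset
  derivable with depth \<open>\<omega> \<cdot> (m + 1)\<close> is already derivable with depth \<open>\<omega> \<cdot> m\<close>, up to a finite number of
  inferences. The saturated subsets that are not derivable at this level form a Kripke model that
  refutes the sequent, unless it is derivable. In the case of a formula \<open>CK A\<close> of such a set, if \<open>A\<close> were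
  refuted in no reachable set, then all premises of the rule for \<open>CK A\<close> would be derivable with
  depth below \<open>\<omega> \<cdot> (m + 1)\<close>, and hence the set with depth \<open>\<omega> \<cdot> (m + 1)\<close>, a contradiction.
\<close>

section \<open>Ordinals\<close>

unbundle cardinal_syntax


section \<open>Order types, cardinality of initial segments and bounds of families\<close>

lemma ordinal_cases:
  obtains r where "Well_order r" "x = abs_ordinal r"
  by (induct x rule: ordinal.abs_induct) blast

lemma abs_ordinal_less_iff:
  "Well_order r \<Longrightarrow> Well_order s \<Longrightarrow> abs_ordinal r < abs_ordinal s \<longleftrightarrow> (r, s) \<in> ordLess"
  by (simp add: less_ordinal.abs_eq ordIso_reflexive)

lemma abs_ordinal_eqI:
  assumes "Well_order r" "Well_order s" "(r, s) \<in> ordIso"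
  shows "abs_ordinal r = abs_ordinal s"
  using assms by (intro Quotient3_rel_abs[OF Quotient3_ordinal]) blast

text \<open>Every ordinal below the type of \<open>r\<close> is the type of an initial segment
  \<open>underS r a\<close>, so the elements \<open>a\<close> of \<open>'a + nat\<close> suffice to
  enumerate them.\<close>

lemma card_lessThan_ordinal: "|{..<\<beta>::'a ordinal}| \<le>o |UNIV::('a + nat) set|"
proof -
  obtain r where r: "Well_order r" "\<beta> = abs_ordinal r" by (rule ordinal_cases)
  have "{..<\<beta>} \<subseteq> (\<lambda>a. abs_ordinal (Restr r (underS r a))) ` UNIV"
  proof
    fix x assume x: "x \<in> {..<\<beta>}"
    obtain s where s: "Well_order s" "x = abs_ordinal s" by (rule ordinal_cases)
    have "(s, r) \<in> ordLess" using x r s by (simp add: abs_ordinal_less_iff)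
    then obtain a where "(s, Restr r (underS r a)) \<in> ordIso"
      using ordLess_iff_ordIso_Restr[OF r(1) s(1)] by blast
    then show "x \<in> (\<lambda>a. abs_ordinal (Restr r (underS r a))) ` UNIV"
      using s r(1) abs_ordinal_eqI Well_order_Restr by blast
  qed
  then show ?thesis
    using card_of_image card_of_mono1 ordLeq_transitive by blast
qed

text \<open>If \<open>f x < x\<close>, then strict monotonicity gives \<open>f (f x) < f x\<close>,
  which contradicts the induction hypothesis at \<open>f x\<close>.\<close>

lemma strict_mono_ordinal_ge:
  fixes f :: "'b::wellorder \<Rightarrow> 'b"
  assumes "\<And>x y. x < y \<Longrightarrow> f x < f y"
  shows "x \<le> f x"
proof (induction x rule: less_induct)
  case (less x)
  show ?case
  proof (rule ccontr)
    assume "\<not> x \<le> f x"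
    then have "f x < x" by simp
    then show False using less assms by fastforce
  qed
qed

text \<open>Burali-Forti: otherwise the order on all ordinals, transported to \<open>'a + nat\<close>, would have a
  type exceeding every ordinal.\<close>

lemma not_inj_ordinal: "\<not> inj (g :: 'a ordinal \<Rightarrow> 'a + nat)"
proof
  assume g: "inj g"
  define r where "r = {(g x, g y) |x y. x \<le> y}"
  have Field: "Field r = range g" unfolding r_def Field_def by auto
  have mem: "(g x, g y) \<in> r \<longleftrightarrow> x \<le> y" for x y
    using g by (auto simp: r_def inj_eq)
  have lin: "Linear_order r"
  proof -
    have "refl_on (range g) r" by (auto simp: refl_on_def r_def)
    moreover have "trans r"
    proof (rule transI)
      fix a b c assume "(a, b) \<in> r" "(b, c) \<in> r"
      then obtain x y z where "a = g x" "b = g y" "c = g z" "x \<le> y"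
        unfolding r_def by blast
      then show "(a, c) \<in> r" using \<open>(b, c) \<in> r\<close> by (simp add: mem)
    qed
    moreover have "antisym r"
    proof (rule antisymI)
      fix a b assume "(a, b) \<in> r" "(b, a) \<in> r"
      then obtain x y where "a = g x" "b = g y" "x \<le> y" unfolding r_def by blast
      then show "a = b" using \<open>(b, a) \<in> r\<close> by (simp add: mem)
    qed
    moreover have "total_on (range g) r"
      unfolding total_on_def by (auto simp: mem)
    moreover have "r \<subseteq> range g \<times> range g" unfolding r_def by auto
    ultimately show ?thesis
      by (simp add: linear_order_on_def partial_order_on_def preorder_on_def Field)
  qed
  have wf: "wf (r - Id)"
  proof -
    have "r - Id \<subseteq> inv_image {(x, y). x < y} (inv g)"
      using inv_f_f[OF g] unfolding r_def by (auto simp: inv_image_def le_less)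
    then show ?thesis by (rule wf_subset[rotated]) (simp add: wf)
  qed
  have wo: "Well_order r" using lin wf by (simp add: well_order_on_def)
  \<comment> \<open>\<open>h\<close> sends \<open>x\<close> to the type of the initial segment below
    \<open>g x\<close>. It is strictly increasing on all ordinals, yet bounded by the type of
    \<open>r\<close>; evaluation at that type gives the contradiction.\<close>
  define h where "h x = abs_ordinal (Restr r (underS r (g x)))" for x
  have wor: "Well_order (Restr r A)" for A using wo by (rule Well_order_Restr)
  have wr: "wo_rel r" using wo by (simp add: wo_rel_def)
  have ofl: "wo_rel.ofilter r (underS r (g x))" for x
    using wr by (rule wo_rel.underS_ofilter)
  have less: "h x < h y" if "x < y" for x y
  proof -
    have "underS r (g x) \<subset> underS r (g y)"
    proof -
      have "g x \<in> underS r (g y)" "g x \<notin> underS r (g x)"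
        using that g mem by (auto simp: underS_def inj_eq)
      moreover have "underS r (g x) \<subseteq> underS r (g y)"
        using that g unfolding underS_def r_def by (auto simp: inj_eq)
      ultimately show ?thesis by blast
    qed
    then show ?thesis
      unfolding h_def abs_ordinal_less_iff[OF wor wor]
      using ofilter_subset_ordLess[OF wo ofl ofl] by blast
  qed
  have "h x < abs_ordinal r" for x
    unfolding h_def abs_ordinal_less_iff[OF wor wo]
    using underS_Restr_ordLess[OF wo] Field by blast
  moreover have "abs_ordinal r \<le> h (abs_ordinal r)" using less by (rule strict_mono_ordinal_ge)
  ultimately show False using leD by blast
qed

text \<open>For an unbounded family, the closed initial segments \<open>?A i\<close> would exhaust
  the ordinals. As a union of at most \<open>|'a + nat|\<close> sets of at most that size, the class
  of ordinals would inject into \<open>'a + nat\<close>.\<close>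

lemma ordinal_family_bounded:
  fixes f :: "'b \<Rightarrow> 'a ordinal"
  assumes "|I| \<le>o |UNIV::('a + nat) set|"
  shows "\<exists>\<nu>. \<forall>i\<in>I. f i < \<nu>"
proof (rule ccontr)
  assume "\<not> ?thesis"
  then have unb: "\<And>\<nu>. \<exists>i\<in>I. \<nu> \<le> f i" by (simp add: not_less)
  let ?A = "\<lambda>i. insert (f i) {..<f i}"
  have inf: "infinite (UNIV::('a + nat) set)" by simp
  have "|?A i| \<le>o |UNIV::('a + nat) set|" for i
  proof -
    have "|{f i} \<union> {..<f i}| \<le>o |UNIV::('a + nat) set|"
      by (rule card_of_Un_ordLeq_infinite_Field)
        (use inf in \<open>simp_all add: card_of_singl_ordLeq card_lessThan_ordinal Field_card_of card_of_card_order_on\<close>)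
    then show ?thesis by simp
  qed
  then have "|\<Union>i\<in>I. ?A i| \<le>o |UNIV::('a + nat) set|"
    by (intro card_of_UNION_ordLeq_infinite[OF inf assms] ballI)
  moreover have "(\<Union>i\<in>I. ?A i) = UNIV"
    using unb by (fastforce simp: le_less)
  ultimately have "|UNIV::'a ordinal set| \<le>o |UNIV::('a + nat) set|" by simp
  then obtain g :: "'a ordinal \<Rightarrow> 'a + nat" where "inj g"
    unfolding card_of_ordLeq[symmetric] by blast
  then show False by (simp add: not_inj_ordinal)
qed

lemma ordinal_family_lessThan_bounded:
  fixes f :: "'a ordinal \<Rightarrow> 'a ordinal"
  shows "\<exists>\<nu>. \<forall>\<delta><\<beta>. f \<delta> < \<nu>"
  using ordinal_family_bounded[OF card_lessThan_ordinal, of \<beta> f] by (metis lessThan_iff)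

lemma ordinal_sequence_bounded:
  fixes f :: "nat \<Rightarrow> 'a ordinal"
  shows "\<exists>\<nu>. \<forall>k. f k < \<nu>"
proof -
  have "|UNIV::nat set| \<le>o |UNIV::('a + nat) set|"
    unfolding card_of_ordLeq[symmetric] by (rule exI[of _ Inr]) simp
  from ordinal_family_bounded[OF this, of f] show ?thesis by simp
qed

section \<open>Ordinal addition and multiplication\<close>

lemma zero_ordinal_le [simp]: "0 \<le> (\<alpha>::'a ordinal)"
  unfolding zero_ordinal_def by (rule Least_le) simp

text \<open>The bound for families indexed by an initial segment is a candidate for the
  \<open>LEAST\<close> of the recursion, so the least value exists and inherits the defining
  inequalities. Multiplication and powers are treated alike.\<close>

lemma plus_ordinal_spec:
  fixes \<alpha> \<beta> :: "'a ordinal"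
  shows "\<alpha> \<le> \<alpha> + \<beta>" "\<delta> < \<beta> \<Longrightarrow> \<alpha> + \<delta> < \<alpha> + \<beta>"
proof -
  obtain \<nu> where \<nu>: "\<forall>\<delta><\<beta>. \<alpha> + \<delta> < \<nu>"
    using ordinal_family_lessThan_bounded[of \<beta> "\<lambda>\<delta>. \<alpha> + \<delta>"] by blast
  have "\<exists>\<gamma>. \<alpha> \<le> \<gamma> \<and> (\<forall>\<delta>\<in>{..<\<beta>}. \<alpha> + \<delta> < \<gamma>)"
    using \<nu> by (intro exI[of _ "max \<alpha> \<nu>"]) (auto simp: less_max_iff_disj)
  from LeastI_ex[OF this] have "\<alpha> \<le> \<alpha> + \<beta> \<and> (\<forall>\<delta>\<in>{..<\<beta>}. \<alpha> + \<delta> < \<alpha> + \<beta>)"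
    unfolding plus_ordinal.simps[of \<alpha> \<beta>, symmetric] .
  then show "\<alpha> \<le> \<alpha> + \<beta>" "\<delta> < \<beta> \<Longrightarrow> \<alpha> + \<delta> < \<alpha> + \<beta>" by auto
qed

lemma plus_ordinal_zero: "\<alpha> + 0 = (\<alpha> :: 'a ordinal)"
  by (subst plus_ordinal.simps) (auto intro!: Least_equality simp: leD)

lemma zero_less_one_ordinal: "0 < (1::'a ordinal)"
proof -
  have "\<exists>\<nu>. 0 < (\<nu>::'a ordinal)" using ordinal_sequence_bounded[of "\<lambda>_. 0"] by blast
  then show ?thesis unfolding one_ordinal_def by (rule LeastI_ex)
qed

lemma less_one_ordinal_iff: "\<delta> < 1 \<longleftrightarrow> \<delta> = (0::'a ordinal)"
proof
  assume "\<delta> < 1"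
  then have "\<not> 0 < \<delta>" unfolding one_ordinal_def by (rule not_less_Least)
  then show "\<delta> = 0" by (simp add: order.antisym)
qed (simp add: zero_less_one_ordinal)

lemma less_plus_one_ordinal: "\<alpha> < \<alpha> + (1 :: 'a ordinal)"
  using plus_ordinal_spec(2)[OF zero_less_one_ordinal, of \<alpha>] by (simp add: plus_ordinal_zero)

lemma ord_of_nat_less_omega: "ord_of_nat n < (omega :: 'a ordinal)"
  using LeastI_ex[OF ordinal_sequence_bounded[of ord_of_nat]] unfolding omega_def by blast

lemma ord_of_nat_strict_mono: "m < n \<Longrightarrow> ord_of_nat m < (ord_of_nat n :: 'a ordinal)"
  by (rule lift_Suc_mono_less) (simp_all add: less_plus_one_ordinal)

lemma times_ordinal_spec:
  fixes \<alpha> \<beta> :: "'a ordinal"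
  assumes "\<delta> < \<beta>"
  shows "\<alpha> * \<delta> + \<alpha> \<le> \<alpha> * \<beta>"
proof -
  have "\<exists>\<gamma>. \<forall>\<delta>\<in>{..<\<beta>}. \<alpha> * \<delta> + \<alpha> \<le> \<gamma>"
    using ordinal_family_lessThan_bounded[of \<beta> "\<lambda>\<delta>. \<alpha> * \<delta> + \<alpha>"] by (meson lessThan_iff less_imp_le)
  from LeastI_ex[OF this] have "\<forall>\<delta>\<in>{..<\<beta>}. \<alpha> * \<delta> + \<alpha> \<le> \<alpha> * \<beta>"
    unfolding times_ordinal.simps[of \<alpha> \<beta>, symmetric] .
  then show ?thesis using assms by simp
qed

lemma times_ordinal_zero: "\<alpha> * 0 = (0 :: 'a ordinal)"
  by (subst times_ordinal.simps) (auto intro!: Least_equality simp: leD)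

lemma times_ordinal_strict_mono:
  fixes \<alpha> :: "'a ordinal"
  assumes "0 < \<alpha>" "\<delta> < \<beta>"
  shows "\<alpha> * \<delta> < \<alpha> * \<beta>"
  using times_ordinal_spec[OF assms(2), of \<alpha>] plus_ordinal_spec(2)[OF assms(1), of "\<alpha> * \<delta>"]
  by (simp add: plus_ordinal_zero)

lemma zero_less_omega: "0 < (omega :: 'a ordinal)"
  using ord_of_nat_less_omega[of 0] by simp

lemma le_times_ordinal: "0 < \<alpha> \<Longrightarrow> \<beta> \<le> \<alpha> * (\<beta> :: 'a ordinal)"
  using times_ordinal_strict_mono by (rule strict_mono_ordinal_ge)

section \<open>Powers of \<omega> and their fixpoints\<close>

lemma omega_power_spec:
  fixes \<beta> :: "'a ordinal"
  shows "1 \<le> omega_power \<beta>" "\<delta> < \<beta> \<Longrightarrow> omega_power \<delta> * omega \<le> omega_power \<beta>"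
proof -
  obtain \<nu> where \<nu>: "\<forall>\<delta><\<beta>. omega_power \<delta> * omega < \<nu>"
    using ordinal_family_lessThan_bounded[of \<beta> "\<lambda>\<delta>. omega_power \<delta> * omega"] by blast
  have "\<exists>\<gamma>. 1 \<le> \<gamma> \<and> (\<forall>\<delta>\<in>{..<\<beta>}. omega_power \<delta> * omega \<le> \<gamma>)"
    using \<nu> by (intro exI[of _ "max 1 \<nu>"]) (auto simp: le_max_iff_disj less_imp_le)
  from LeastI_ex[OF this]
  have "1 \<le> omega_power \<beta> \<and> (\<forall>\<delta>\<in>{..<\<beta>}. omega_power \<delta> * omega \<le> omega_power \<beta>)"
    unfolding omega_power.simps[of \<beta>, symmetric] .
  then show "1 \<le> omega_power \<beta>" "\<delta> < \<beta> \<Longrightarrow> omega_power \<delta> * omega \<le> omega_power \<beta>" by auto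
qed

lemma omega_power_pos: "0 < omega_power \<beta>"
  using omega_power_spec(1) zero_less_one_ordinal by (rule less_le_trans[rotated])

lemma omega_power_least:
  assumes "1 \<le> \<gamma>" "\<And>\<delta>. \<delta> < \<beta> \<Longrightarrow> omega_power \<delta> * omega \<le> \<gamma>"
  shows "omega_power \<beta> \<le> \<gamma>"
  unfolding omega_power.simps[of \<beta>] by (rule Least_le) (simp add: assms)

lemma omega_power_strict_mono:
  fixes \<beta> :: "'a ordinal"
  assumes "\<delta> < \<beta>"
  shows "omega_power \<delta> < omega_power \<beta>"
proof -
  let ?x = "omega_power \<delta>"
  have one: "(1::'a ordinal) < omega"
  proof -
    have "1 \<le> (ord_of_nat 1 :: 'a ordinal)"
      unfolding one_ordinal_def by (rule Least_le) (simp add: less_plus_one_ordinal)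
    then show ?thesis using ord_of_nat_less_omega by (rule le_less_trans)
  qed
  \<comment> \<open>Strict monotonicity of adding on the right of \<open>0\<close> gives this
    inequality without computing \<open>0 + ?x\<close>.\<close>
  have "?x \<le> 0 + ?x" using plus_ordinal_spec(2) by (rule strict_mono_ordinal_ge)
  also have "\<dots> \<le> ?x * 1"
    using times_ordinal_spec[OF zero_less_one_ordinal, of ?x] by (simp add: times_ordinal_zero)
  also have "\<dots> < ?x * omega" using omega_power_pos one by (rule times_ordinal_strict_mono)
  also have "\<dots> \<le> omega_power \<beta>" using assms by (rule omega_power_spec(2))
  finally show ?thesis .
qed

lemma le_omega_power: "\<beta> \<le> omega_power \<beta>"
  using omega_power_strict_mono by (rule strict_mono_ordinal_ge)

text \<open>The supremum \<xi> of the iterates of \<open>omega_power\<close> from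
  \<open>\<nu> + 1\<close> is a fixpoint: any \<open>\<delta> < \<xi>\<close> lies below some
  \<open>s k\<close>, whence
  \<open>omega_power \<delta> * omega \<le> s (Suc k) \<le> \<xi>\<close>.\<close>

lemma omega_power_fixpoint_above:
  fixes \<nu> :: "'a ordinal"
  shows "\<exists>\<xi>. omega_power \<xi> = \<xi> \<and> \<nu> < \<xi>"
proof -
  define s where "s k = (omega_power ^^ k) (\<nu> + 1)" for k
  have s0: "s 0 = \<nu> + 1" and sS: "s (Suc k) = omega_power (s k)" for k
    by (simp_all add: s_def)
  define \<xi> where "\<xi> = (LEAST \<gamma>. \<forall>k. s k \<le> \<gamma>)"
  have "\<exists>\<gamma>. \<forall>k. s k \<le> \<gamma>"
    using ordinal_sequence_bounded[of s] less_imp_le by blast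
  then have ub: "s k \<le> \<xi>" for k unfolding \<xi>_def by (rule LeastI2_ex) simp
  have "omega_power \<xi> \<le> \<xi>"
  proof (rule omega_power_least)
    show "1 \<le> \<xi>" using omega_power_spec(1)[of "s 0"] ub[of 1] sS[of 0] by simp
    fix \<delta> assume "\<delta> < \<xi>"
    then have "\<not> (\<forall>k. s k \<le> \<delta>)" unfolding \<xi>_def by (rule not_less_Least)
    then obtain k where k: "\<delta> < s k" by (auto simp: not_le)
    then show "omega_power \<delta> * omega \<le> \<xi>"
      using omega_power_spec(2)[OF k] ub[of "Suc k"] sS[of k] by simp
  qed
  moreover have "\<nu> < \<xi>" using less_plus_one_ordinal[of \<nu>] ub[of 0] s0 by simp
  ultimately show ?thesis using le_omega_power[of \<xi>] by (meson order.antisym)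
qed

lemma omega_le_fixpoint:
  fixes \<xi> :: "'a ordinal"
  assumes "omega_power \<xi> = \<xi>"
  shows "omega \<le> \<xi>"
proof -
  have "0 < \<xi>" using omega_power_pos[of \<xi>] assms by simp
  then have "omega_power 0 * omega \<le> \<xi>" using omega_power_spec(2)[of 0 \<xi>] assms by simp
  then show ?thesis using le_times_ordinal[OF omega_power_pos, of omega 0] by (rule order_trans[rotated])
qed

text \<open>\<open>veblen 1\<close> enumerates the fixpoints of \<open>omega_power\<close>. As these
  are unbounded, the \<open>LEAST\<close> of the enumeration exists, so each value is such a
  fixpoint.\<close>

lemma veblen_one_ge_omega:
  fixes \<beta> :: "'a ordinal"
  shows "omega \<le> veblen 1 \<beta>"
proof -
  let ?X = "{\<xi>::'a ordinal. omega_power \<xi> = \<xi>}"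
  have *: "veblen 1 = enum_ord ?X"
  proof -
    have "{\<xi>::'a ordinal. \<forall>\<gamma>\<in>{..<1}. veblen \<gamma> \<xi> = \<xi>} = ?X"
      by (auto simp: less_one_ordinal_iff veblen.simps[of 0])
    then show ?thesis
      using zero_less_one_ordinal[where ?'a = 'a] by (subst veblen.simps) auto
  qed
  obtain \<nu> where \<nu>: "\<forall>\<delta><\<beta>. enum_ord ?X \<delta> < \<nu>"
    using ordinal_family_lessThan_bounded by blast
  obtain \<xi> where "omega_power \<xi> = \<xi>" "\<nu> < \<xi>" using omega_power_fixpoint_above by blast
  with \<nu> have "\<exists>\<xi>. \<xi> \<in> ?X \<and> (\<forall>\<delta>\<in>{..<\<beta>}. enum_ord ?X \<delta> < \<xi>)" by force
  from LeastI_ex[OF this] have "enum_ord ?X \<beta> \<in> ?X"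
    unfolding enum_ord.simps[of ?X \<beta>, symmetric] by blast
  then show ?thesis using omega_le_fixpoint * by simp
qed

section \<open>Kripke semantics\<close>

primrec holds :: "('i \<Rightarrow> 'w \<Rightarrow> 'w \<Rightarrow> bool) \<Rightarrow> ('p \<Rightarrow> 'w \<Rightarrow> bool) \<Rightarrow> 'w \<Rightarrow> ('p, 'i) form \<Rightarrow> bool" where
  "holds R V w (Pos p) \<longleftrightarrow> V p w"
| "holds R V w (Neg p) \<longleftrightarrow> \<not> V p w"
| "holds R V w (Or A B) \<longleftrightarrow> holds R V w A \<or> holds R V w B"
| "holds R V w (And A B) \<longleftrightarrow> holds R V w A \<and> holds R V w B"
| "holds R V w (Dia i A) \<longleftrightarrow> (\<exists>v. R i w v \<and> holds R V v A)"
| "holds R V w (Box i A) \<longleftrightarrow> (\<forall>v. R i w v \<longrightarrow> holds R V v A)"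
| "holds R V w (CKd A) \<longleftrightarrow> (\<exists>v. (\<lambda>x y. \<exists>i. R i x y)\<^sup>+\<^sup>+ w v \<and> holds R V v A)"
| "holds R V w (CK A) \<longleftrightarrow> (\<forall>v. (\<lambda>x y. \<exists>i. R i x y)\<^sup>+\<^sup>+ w v \<longrightarrow> holds R V v A)"

lemma holds_dual: "holds R V w (dual A) \<longleftrightarrow> \<not> holds R V w A"
  by (induction A arbitrary: w) auto

lemma holds_foldl_Or: "holds R V w (foldl Or A As) \<longleftrightarrow> (\<exists>B\<in>set (A # As). holds R V w B)"
  by (induction As arbitrary: A) auto

lemma holds_foldl_And: "holds R V w (foldl And A As) \<longleftrightarrow> (\<forall>B\<in>set (A # As). holds R V w B)"
  by (induction As arbitrary: A) auto

lemma set_agents: "set (agents :: 'i::{finite, linorder} list) = UNIV"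
  by (simp add: agents_def)

lemma agents_nonempty: "agents \<noteq> ([] :: 'i::{finite, linorder} list)"
  using set_agents[where 'i = 'i] by force

lemma map_agents_Cons:
  "hd (map f agents) # tl (map f agents) = map f (agents :: 'i::{finite, linorder} list)"
  by (simp add: agents_nonempty)

lemma holds_dia_all: "holds R V w (dia_all A) \<longleftrightarrow> (\<exists>i v. R i w v \<and> holds R V v A)"
  unfolding dia_all_def big_def holds_foldl_Or map_agents_Cons by (simp add: set_agents)

lemma holds_box_all: "holds R V w (box_all A) \<longleftrightarrow> (\<forall>i v. R i w v \<longrightarrow> holds R V v A)"
  unfolding box_all_def big_def holds_foldl_And map_agents_Cons by (simp add: set_agents)

lemma holds_box_all_funpow:
  "holds R V w ((box_all ^^ k) A) \<longleftrightarrow> (\<forall>v. ((\<lambda>x y. \<exists>i. R i x y) ^^ k) w v \<longrightarrow> holds R V v A)"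
proof (induction k arbitrary: w)
  case (Suc k)
  let ?r = "\<lambda>x y. \<exists>i. R i x y"
  \<comment> \<open>A relational power splits off its last step by definition, whereas the outermost
    \<open>box_all\<close> speaks about the first one.\<close>
  have "(?r ^^ Suc k) w v \<longleftrightarrow> (\<exists>u. ?r w u \<and> (?r ^^ k) u v)" for v
    using relpowp_Suc_I2[of ?r w] relpowp_Suc_D2[of k ?r w v] by blast
  then show ?case unfolding funpow.simps(2) o_apply holds_box_all Suc by blast
qed simp

text \<open>The transitive closure is the union of the positive powers, which are matched by the
  premises of the infinitary rule.\<close>

lemma holds_CK: "holds R V w (CK A) \<longleftrightarrow> (\<forall>k. holds R V w ((box_all ^^ Suc k) A))"
  unfolding holds_box_all_funpow holds.simps tranclp_power gr0_conv_Suc by blast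

lemma tranclp_iff_step: "r\<^sup>+\<^sup>+ x y \<longleftrightarrow> r x y \<or> (\<exists>z. r x z \<and> r\<^sup>+\<^sup>+ z y)"
proof
  assume "r\<^sup>+\<^sup>+ x y"
  then show "r x y \<or> (\<exists>z. r x z \<and> r\<^sup>+\<^sup>+ z y)" by (rule converse_tranclpE) auto
qed (elim disjE exE conjE, erule tranclp.r_into_trancl, erule (1) tranclp_into_tranclp2)

text \<open>A nonempty path is a single step or a step followed by a nonempty path. This unfolding
  justifies both the rule for \<open>CKd\<close> and the \<open>CKd\<close> context of the box
  rule.\<close>

lemma holds_CKd:
  "holds R V w (CKd A) \<longleftrightarrow> holds R V w (dia_all A) \<or> (\<exists>i v. R i w v \<and> holds R V v (CKd A))"
proof -
  let ?r = "\<lambda>x y. \<exists>i. R i x y"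
  have "?r\<^sup>+\<^sup>+ w v \<longleftrightarrow> (\<exists>i. R i w v) \<or> (\<exists>z. (\<exists>i. R i w z) \<and> ?r\<^sup>+\<^sup>+ z v)" for v
    by (rule tranclp_iff_step)
  then have "holds R V w (CKd A) \<longleftrightarrow>
      (\<exists>v. ((\<exists>i. R i w v) \<or> (\<exists>z. (\<exists>i. R i w z) \<and> ?r\<^sup>+\<^sup>+ z v)) \<and> holds R V v A)"
    unfolding holds.simps by (simp only:)
  then show ?thesis unfolding holds_dia_all holds.simps(7)[of R V _ A] by blast
qed

text \<open>The world \<open>w\<close> is kept arbitrary in the induction, because the box rule uses
  its premise at a successor; cuts of any rank are sound by \<open>holds_dual\<close>.\<close>

lemma soundness:
  assumes "is_proof \<gamma> \<pi>"
  shows "\<exists>A\<in>#concl \<pi>. holds R V w A"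
  using assms
proof (induction \<pi> arbitrary: w)
  case (Leaf \<Gamma>)
  then show ?case by (auto elim!: axiom_inf.cases)
next
  case (Unary \<Gamma> \<pi>)
  then have inf: "unary_inf (concl \<pi>) \<Gamma>" and IH: "\<And>w. \<exists>A\<in>#concl \<pi>. holds R V w A" by simp_all
  from inf show ?case
  proof cases
    case (or_inf \<Gamma>' A B)
    then show ?thesis using IH[of w] by auto
  next
    case (box_inf \<Theta> \<Delta> A i \<Sigma>)
    show ?thesis
    proof (cases "holds R V w (Box i A)")
      case False
      then obtain v where v: "R i w v" "\<not> holds R V v A" by auto
      \<comment> \<open>The formula true at \<open>v\<close> is not \<open>A\<close>, hence it comes
        from the context, which transfers truth from \<open>v\<close> back to
        \<open>w\<close>.\<close>
      with IH[of v] box_inf obtain B where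
        "B \<in># \<Theta> \<and> holds R V v B \<or> B \<in># \<Delta> \<and> holds R V v (CKd B)" by (auto simp del: holds.simps)
      then have "B \<in># \<Theta> \<and> holds R V w (Dia i B) \<or> B \<in># \<Delta> \<and> holds R V w (CKd B)"
        using v holds_CKd[of R V w B] by auto
      then show ?thesis using box_inf by (auto simp del: holds.simps)
    qed (use box_inf in auto)
  next
    case (CKd_inf \<Gamma>' A)
    then show ?thesis using IH[of w] holds_CKd[of R V w A] by (auto simp del: holds.simps)
  qed
next
  case (Binary \<Gamma> \<pi> \<rho>)
  then have IH: "\<exists>A\<in>#concl \<pi>. holds R V w A" "\<exists>A\<in>#concl \<rho>. holds R V w A" by simp_all
  from Binary.prems have "and_inf (concl \<pi>) (concl \<rho>) \<Gamma> \<or> cut_inf \<gamma> (concl \<pi>) (concl \<rho>) \<Gamma>" by simp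
  then show ?case
    using IH by (auto elim!: and_inf.cases cut_inf.cases simp: holds_dual)
next
  case (Infinitary \<Gamma> f)
  then have inf: "CK_inf (\<lambda>k. concl (f k)) \<Gamma>" and IH: "\<And>k. \<exists>A\<in>#concl (f k). holds R V w A"
    by auto
  from inf show ?case
  proof cases
    case (1 \<Gamma>' A)
    then have c: "concl (f k) = \<Gamma>' + {#(box_all ^^ Suc k) A#}" for k
      using fun_cong[OF 1(1)] by blast
    show ?thesis
    proof (cases "holds R V w (CK A)")
      case False
      then obtain k where "\<not> holds R V w ((box_all ^^ Suc k) A)" unfolding holds_CK by blast
      then show ?thesis using IH[of k] 1 unfolding c by auto
    qed (use 1 in simp)
  qed
qed

section \<open>Derivability\<close>

lemma derivable_mono: "GC_derivable \<alpha> \<gamma> \<Gamma> \<Longrightarrow> \<alpha> \<le> \<beta> \<Longrightarrow> GC_derivable \<beta> \<gamma> \<Gamma>"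
  unfolding GC_derivable_def using order_trans by blast

lemma derivable_axiom: "Pos p \<in># M \<Longrightarrow> Neg p \<in># M \<Longrightarrow> GC_derivable \<alpha> \<gamma> M"
proof -
  assume p: "Pos p \<in># M" "Neg p \<in># M"
  then obtain \<Gamma> where "M = add_mset (Pos p) \<Gamma>" by (blast dest: multi_member_split)
  moreover from this p obtain \<Gamma>' where "\<Gamma> = add_mset (Neg p) \<Gamma>'"
    by (auto dest: multi_member_split)
  ultimately have "M = \<Gamma>' + {#Pos p, Neg p#}" by simp
  then have "axiom_inf M" by (simp only: axiom_inf.intros)
  then show ?thesis unfolding GC_derivable_def by (intro exI[of _ "Leaf M"]) simp
qed

lemma derivable_unary:
  assumes "unary_inf \<Delta> \<Gamma>" "GC_derivable \<alpha> \<gamma> \<Delta>" "\<alpha> < \<beta>"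
  shows "GC_derivable \<beta> \<gamma> \<Gamma>"
proof -
  obtain \<pi> where "is_proof \<gamma> \<pi>" "concl \<pi> = \<Delta>" "depth \<pi> \<le> \<alpha>"
    using assms unfolding GC_derivable_def by blast
  then show ?thesis using assms unfolding GC_derivable_def
    by (intro exI[of _ "Unary \<Gamma> \<pi>"]) (auto intro: Least_le)
qed

lemma derivable_and:
  assumes "GC_derivable \<alpha> \<gamma> (\<Gamma> + {#A#})" "GC_derivable \<alpha> \<gamma> (\<Gamma> + {#B#})" "\<alpha> < \<beta>"
  shows "GC_derivable \<beta> \<gamma> (\<Gamma> + {#And A B#})"
proof -
  obtain \<pi> \<rho> where "is_proof \<gamma> \<pi>" "concl \<pi> = \<Gamma> + {#A#}" "depth \<pi> \<le> \<alpha>"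
    and "is_proof \<gamma> \<rho>" "concl \<rho> = \<Gamma> + {#B#}" "depth \<rho> \<le> \<alpha>"
    using assms unfolding GC_derivable_def by blast
  then show ?thesis using assms(3) and_inf.intros[of \<Gamma> A B] unfolding GC_derivable_def
    by (intro exI[of _ "Binary (\<Gamma> + {#And A B#}) \<pi> \<rho>"]) (auto intro: Least_le)
qed

lemma derivable_CK:
  assumes "\<And>k. GC_derivable (\<alpha> k) \<gamma> (\<Gamma> + {#(box_all ^^ Suc k) A#})" "\<And>k. \<alpha> k < \<beta>"
  shows "GC_derivable \<beta> \<gamma> (\<Gamma> + {#CK A#})"
proof -
  have "\<forall>k. \<exists>\<pi>. is_proof \<gamma> \<pi> \<and> concl \<pi> = \<Gamma> + {#(box_all ^^ Suc k) A#} \<and> depth \<pi> \<le> \<alpha> k"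
    using assms(1) unfolding GC_derivable_def by blast
  from choice[OF this] obtain f where f: "\<And>k. is_proof \<gamma> (f k)"
    "\<And>k. concl (f k) = \<Gamma> + {#(box_all ^^ Suc k) A#}" "\<And>k. depth (f k) \<le> \<alpha> k"
    by blast
  have "CK_inf (\<lambda>k. concl (f k)) (\<Gamma> + {#CK A#})" unfolding f(2) by (rule CK_inf.intros)
  moreover have "depth (Infinitary (\<Gamma> + {#CK A#}) f) \<le> \<beta>"
    using f(3) assms(2) by (auto intro!: Least_le intro: le_less_trans)
  ultimately show ?thesis using f(1) unfolding GC_derivable_def
    by (intro exI[of _ "Infinitary (\<Gamma> + {#CK A#}) f"]) simp
qed

section \<open>Finite cost of introducing iterated connectives\<close>

lemma less_plus_Suc: "\<alpha> + ord_of_nat n < \<alpha> + (ord_of_nat (Suc n) :: 'a ordinal)"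
  by (intro plus_ordinal_spec(2) ord_of_nat_strict_mono) simp

lemma plus_ord_of_nat_mono: "m \<le> n \<Longrightarrow> \<alpha> + ord_of_nat m \<le> \<alpha> + (ord_of_nat n :: 'a ordinal)"
  by (cases "m = n") (auto intro!: less_imp_le plus_ordinal_spec(2) ord_of_nat_strict_mono)

lemma derivable_foldl_Or:
  assumes "GC_derivable (\<alpha> + ord_of_nat n) \<gamma> (\<Gamma> + mset (A # As))"
  shows "GC_derivable (\<alpha> + ord_of_nat (n + length As)) \<gamma> (\<Gamma> + {#foldl Or A As#})"
  using assms
proof (induction As arbitrary: A n)
  case (Cons B As)
  then have "GC_derivable (\<alpha> + ord_of_nat n) \<gamma> ((\<Gamma> + mset As) + {#A, B#})"
    by (simp add: ac_simps)
  from derivable_unary[OF or_inf this less_plus_Suc]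
  have "GC_derivable (\<alpha> + ord_of_nat (Suc n)) \<gamma> (\<Gamma> + mset (Or A B # As))"
    by (simp add: ac_simps)
  from Cons.IH[OF this] show ?case by simp
qed simp

lemma derivable_foldl_And:
  assumes "\<And>B. B \<in> set (A # As) \<Longrightarrow> GC_derivable (\<alpha> + ord_of_nat n) \<gamma> (\<Gamma> + {#B#})"
  shows "GC_derivable (\<alpha> + ord_of_nat (n + length As)) \<gamma> (\<Gamma> + {#foldl And A As#})"
  using assms
proof (induction As arbitrary: A n)
  case (Cons B As)
  have "GC_derivable (\<alpha> + ord_of_nat (Suc n)) \<gamma> (\<Gamma> + {#D#})" if "D \<in> set (And A B # As)" for D
  proof (cases "D = And A B")
    case True
    then show ?thesis
      using derivable_and[OF Cons.prems[of A] Cons.prems[of B] less_plus_Suc] by simp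
  next
    case False
    then show ?thesis
      using that derivable_mono[OF Cons.prems[of D] less_imp_le[OF less_plus_Suc]] by simp
  qed
  from Cons.IH[OF this] show ?case by simp
qed simp

lemma derivable_box_all:
  fixes A :: "('p, 'i::{finite, linorder}) form"
  assumes "\<And>i. GC_derivable (\<alpha> + ord_of_nat n) \<gamma> (\<Gamma> + {#Box i A#})"
  shows "GC_derivable (\<alpha> + ord_of_nat (n + length (tl (agents :: 'i list)))) \<gamma>
    (\<Gamma> + {#box_all A#})"
proof -
  let ?B = "map (\<lambda>i. Box i A) (agents :: 'i list)"
  have "GC_derivable (\<alpha> + ord_of_nat (n + length (tl ?B))) \<gamma>
      (\<Gamma> + {#foldl And (hd ?B) (tl ?B)#})"
    by (rule derivable_foldl_And, unfold map_agents_Cons) (use assms in auto)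
  then show ?thesis unfolding box_all_def big_def by simp
qed

lemma derivable_dia_all:
  fixes A :: "('p, 'i::{finite, linorder}) form"
  assumes "GC_derivable (\<alpha> + ord_of_nat n) \<gamma> (\<Gamma> + mset (map (\<lambda>i. Dia i A) agents))"
  shows "GC_derivable (\<alpha> + ord_of_nat (n + length (tl (agents :: 'i list)))) \<gamma>
    (\<Gamma> + {#dia_all A#})"
proof -
  let ?D = "map (\<lambda>i. Dia i A) (agents :: 'i list)"
  have "GC_derivable (\<alpha> + ord_of_nat n) \<gamma> (\<Gamma> + mset (hd ?D # tl ?D))"
    using assms by (simp only: map_agents_Cons)
  from derivable_foldl_Or[OF this] show ?thesis unfolding dia_all_def big_def by simp
qed

section \<open>Covering of sets by sequents\<close>

text \<open>
  Weakening and inversion of the rule for \<open>CK\<close> are built into this relation: an element \<open>CK A\<close> of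
  the set may be represented in the sequent by any of the active formulas of that rule.
\<close>

definition represents :: "('p, 'i::{finite, linorder}) form \<Rightarrow> ('p, 'i) form \<Rightarrow> bool" where
  "represents G F \<longleftrightarrow> G = F \<or> (\<exists>A k. F = CK A \<and> G = (box_all ^^ Suc k) A)"

definition covers :: "('p, 'i::{finite, linorder}) sequent \<Rightarrow> ('p, 'i) form set \<Rightarrow> bool" where
  "covers M S \<longleftrightarrow> (\<exists>r. (\<forall>F\<in>S. represents (r F) F) \<and> image_mset r (mset_set S) \<subseteq># M)"

lemma represents_refl: "represents F F"
  by (simp add: represents_def)

lemma covers_subset:
  fixes S :: "('p, 'i::{finite, linorder}) form set"
  assumes "covers M S" "T \<subseteq> S" "finite S"
  shows "covers M T"
proof -
  have "mset_set T \<subseteq># mset_set S" using assms by (simp add: subset_imp_msubset_mset_set)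
  then have "image_mset r (mset_set T) \<subseteq># image_mset r (mset_set S)" for r :: "('p, 'i) form \<Rightarrow> ('p, 'i) form"
    by (rule image_mset_subseteq_mono)
  then show ?thesis using assms(1,2) unfolding covers_def by (meson subset_iff subset_mset.order_trans)
qed

text \<open>Covering asks for one occurrence per element, so further copies in \<open>M\<close>
  count as weakening.\<close>

lemma covers_set_mset: "covers M (set_mset M)"
  unfolding covers_def
  by (rule exI[of _ id]) (simp add: represents_def mset_set_set_mset_msubset)

lemma covers_insert:
  assumes "covers M S" "finite S" "represents G F"
  shows "covers (M + {#G#}) (insert F S)"
proof -
  obtain r where r: "\<forall>F\<in>S. represents (r F) F" "image_mset r (mset_set S) \<subseteq># M"
    using assms(1) unfolding covers_def by blast
  show ?thesis
  proof (cases "F \<in> S")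
    case True
    then show ?thesis unfolding covers_def using r
      by (intro exI[of _ r]) (auto simp: insert_absorb intro: subset_mset.order_trans)
  next
    case False
    then have "image_mset (r(F := G)) (mset_set S) = image_mset r (mset_set S)"
      using assms(2) by (intro image_mset_cong) auto
    then show ?thesis unfolding covers_def using r assms False
      by (intro exI[of _ "r(F := G)"]) auto
  qed
qed

lemma covers_union_list:
  assumes "covers M S" "finite S"
  shows "covers (M + mset Fs) (S \<union> set Fs)"
proof (induction Fs)
  case (Cons F Fs)
  have "covers ((M + mset Fs) + {#F#}) (insert F (S \<union> set Fs))"
    using Cons assms represents_refl by (intro covers_insert) auto
  then show ?case by simp
qed (use assms in simp)

text \<open>Isolates the representative of \<open>F\<close> as principal formula, while the
  remaining sequent covers the other elements and can serve as context.\<close>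

lemma covers_remove:
  assumes "covers M S" "finite S" "F \<in> S"
  obtains M' G where "M = M' + {#G#}" "represents G F" "covers M' (S - {F})"
proof -
  obtain r where r: "\<forall>F\<in>S. represents (r F) F" "image_mset r (mset_set S) \<subseteq># M"
    using assms(1) unfolding covers_def by blast
  have "mset_set S = add_mset F (mset_set (S - {F}))"
    using assms by (simp add: mset_set.remove)
  then obtain D where D: "M = add_mset (r F) (image_mset r (mset_set (S - {F}))) + D"
    using r(2) unfolding mset_subset_eq_exists_conv by auto
  show ?thesis
  proof
    show "M = (image_mset r (mset_set (S - {F})) + D) + {#r F#}" using D by simp
    show "represents (r F) F" using r assms by blast
    show "covers (image_mset r (mset_set (S - {F})) + D) (S - {F})"
      unfolding covers_def using r(1) by (intro exI[of _ r]) auto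
  qed
qed

text \<open>Only formulas \<open>CK A\<close> admit representatives other than themselves, so all
  others occur literally in \<open>M\<close>.\<close>

lemma covers_msubset:
  assumes "covers M S" "finite S" "T \<subseteq> S" "\<And>A. CK A \<notin> T"
  shows "mset_set T \<subseteq># M"
proof -
  have "covers M T" using assms covers_subset by blast
  then obtain r where r: "\<forall>F\<in>T. represents (r F) F" "image_mset r (mset_set T) \<subseteq># M"
    unfolding covers_def by blast
  have "image_mset r (mset_set T) = image_mset id (mset_set T)"
    using r(1) assms finite_subset[of T S] unfolding represents_def by (intro image_mset_cong) auto
  then show ?thesis using r(2) by simp
qed

lemma covers_member:
  assumes "covers M S" "finite S" "F \<in> S" "\<And>A. F \<noteq> CK A"
  shows "F \<in># M"
  using covers_msubset[OF assms(1,2), of "{F}"] assms(3,4) by auto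

text \<open>Derivability without cut from level \<delta> up to finitely many further inferences. The
  finite part \<open>n\<close> is uniform in the covering sequents. \<open>C\<close> is a literal
  side sequent; it carries the formulas \<open>(box_all ^^ k) A\<close>, which may lie outside the
  finite closure.\<close>

definition prov :: "'a ordinal \<Rightarrow> ('p, 'i::{finite, linorder}) form set \<Rightarrow> ('p, 'i) sequent \<Rightarrow> bool" where
  "prov \<delta> S C \<longleftrightarrow> (\<exists>n. \<forall>M. covers M S \<longrightarrow> GC_derivable (\<delta> + ord_of_nat n) 0 (M + C))"

text \<open>The formulas \<open>Dia i A\<close> are joined to \<open>dia_all A\<close>, which the
  rule for \<open>CKd\<close> absorbs into the \<open>CKd A\<close> present in every covering
  sequent.\<close>

lemma prov_dia:
  fixes A :: "('p, 'i::{finite, linorder}) form"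
  assumes "prov \<delta> (S \<union> range (\<lambda>i. Dia i A)) C" "finite S" "CKd A \<in> S"
  shows "prov \<delta> S C"
proof -
  let ?D = "map (\<lambda>i. Dia i A) (agents :: 'i list)"
  obtain n where n: "\<And>M. covers M (S \<union> range (\<lambda>i. Dia i A)) \<Longrightarrow>
      GC_derivable (\<delta> + ord_of_nat n) 0 (M + C)"
    using assms(1) unfolding prov_def by blast
  let ?k = "n + length (tl (agents :: 'i list))"
  have "GC_derivable (\<delta> + ord_of_nat (Suc ?k)) 0 (M + C)" if M: "covers M S" for M
  proof -
    have "covers (M + mset ?D) (S \<union> set ?D)"
      using M assms(2) by (rule covers_union_list)
    then have "covers (M + mset ?D) (S \<union> range (\<lambda>i. Dia i A))"
      by (simp only: set_map set_agents)
    from n[OF this] have "GC_derivable (\<delta> + ord_of_nat n) 0 ((M + C) + mset ?D)"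
      by (simp only: ac_simps)
    then have *: "GC_derivable (\<delta> + ord_of_nat ?k) 0 ((M + C) + {#dia_all A#})"
      by (rule derivable_dia_all)
    obtain M' where M': "M = M' + {#CKd A#}"
      using covers_member[OF M assms(2,3)] by (metis add.commute add_mset_add_single form.distinct(55) insert_DiffM)
    have "GC_derivable (\<delta> + ord_of_nat ?k) 0 ((M' + C) + {#CKd A, dia_all A#})"
      using * M' by (simp add: ac_simps)
    from derivable_unary[OF CKd_inf this less_plus_Suc]
    show ?thesis using M' by (simp add: ac_simps)
  qed
  then show ?thesis unfolding prov_def by blast
qed

text \<open>One round is enough: the added formulas are diamonds and thus create no new
  \<open>CKd\<close> formula.\<close>

definition saturate :: "('p, 'i) form set \<Rightarrow> ('p, 'i) form set" where
  "saturate S = S \<union> (\<Union>A\<in>CKd -` S. range (\<lambda>i. Dia i A))"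

lemma prov_saturate:
  assumes "prov \<delta> (saturate S) C" "finite S"
  shows "prov \<delta> S C"
proof -
  have "T \<subseteq> CKd -` S \<Longrightarrow> prov \<delta> (S \<union> (\<Union>A\<in>T. range (\<lambda>i. Dia i A))) C \<Longrightarrow> prov \<delta> S C"
    if "finite T" for T
    using that
  proof (induction T)
    case (insert A T)
    have "prov \<delta> (S \<union> (\<Union>A\<in>T. range (\<lambda>i. Dia i A)) \<union> range (\<lambda>i. Dia i A)) C"
      using insert.prems(2) by (simp add: Un_ac)
    then have "prov \<delta> (S \<union> (\<Union>A\<in>T. range (\<lambda>i. Dia i A))) C"
      by (rule prov_dia) (use insert assms(2) in auto)
    then show ?case using insert by simp
  qed simp
  moreover have "finite (CKd -` S)" using assms(2) by (intro finite_vimageI) (auto intro: injI)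
  ultimately show ?thesis using assms(1) unfolding saturate_def by blast
qed

text \<open>The context of the premise when the box rule for agent \<open>i\<close> is applied
  backwards to \<open>S\<close>. Formulas \<open>Box j B\<close> and \<open>CK B\<close> of
  \<open>S\<close> leave no trace in it.\<close>

definition step :: "'i \<Rightarrow> ('p, 'i) form set \<Rightarrow> ('p, 'i) sequent" where
  "step i S = mset_set (Dia i -` S) + image_mset CKd (mset_set (CKd -` S))"

lemma in_step:
  assumes "finite S"
  shows "F \<in># step i S \<longleftrightarrow> Dia i F \<in> S \<or> (\<exists>A. F = CKd A \<and> CKd A \<in> S)"
proof -
  have "finite (Dia i -` S)" "finite (CKd -` S)"
    using assms by (auto intro!: finite_vimageI injI)
  then show ?thesis by (auto simp: step_def)
qed

text \<open>The formulas \<open>Dia i B\<close> and \<open>CKd B\<close> of \<open>S\<close> occur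
  literally in \<open>M\<close>; whatever else \<open>M\<close> contains becomes the weakening part
  \<Sigma> of the rule.\<close>

lemma derivable_box:
  assumes "covers M S" "finite S" "GC_derivable \<alpha> 0 (step i S + {#A#})" "\<alpha> < \<beta>"
  shows "GC_derivable \<beta> 0 (M + {#Box i A#})"
proof -
  let ?\<Gamma> = "mset_set (Dia i -` S)" and ?\<Delta> = "mset_set (CKd -` S)"
  have fin: "finite (Dia i -` S)" "finite (CKd -` S)"
    using assms by (auto intro!: finite_vimageI injI)
  have "image_mset (Dia i) ?\<Gamma> + image_mset CKd ?\<Delta> =
      mset_set (Dia i ` (Dia i -` S) \<union> CKd ` (CKd -` S))"
    using fin by (subst mset_set_Union) (auto simp: image_mset_mset_set inj_on_def simp del: image_vimage_eq)
  also have "\<dots> \<subseteq># M" using assms(1,2) by (rule covers_msubset) auto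
  finally obtain \<Sigma> where "M = image_mset (Dia i) ?\<Gamma> + image_mset CKd ?\<Delta> + \<Sigma>"
    unfolding mset_subset_eq_exists_conv by blast
  then have "unary_inf (step i S + {#A#}) (M + {#Box i A#})"
    using box_inf[of ?\<Gamma> ?\<Delta> A i \<Sigma>] by (simp add: step_def ac_simps)
  then show ?thesis using assms(3,4) by (rule derivable_unary)
qed

section \<open>Completeness with bounded depth\<close>

text \<open>Members of \<open>S\<close> are meant to be false. Disjunctions and conjunctions are
  evaluated from their parts, so the sets need not be closed under propositional analysis.\<close>

primrec refutes :: "('p, 'i) form set \<Rightarrow> ('p, 'i) form \<Rightarrow> bool" where
  "refutes S (Pos p) \<longleftrightarrow> Pos p \<in> S"
| "refutes S (Neg p) \<longleftrightarrow> Neg p \<in> S"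
| "refutes S (Or A B) \<longleftrightarrow> refutes S A \<and> refutes S B"
| "refutes S (And A B) \<longleftrightarrow> refutes S A \<or> refutes S B"
| "refutes S (Dia i A) \<longleftrightarrow> Dia i A \<in> S"
| "refutes S (Box i A) \<longleftrightarrow> Box i A \<in> S"
| "refutes S (CKd A) \<longleftrightarrow> CKd A \<in> S"
| "refutes S (CK A) \<longleftrightarrow> CK A \<in> S"

lemma refutes_mono: "refutes S F \<Longrightarrow> S \<subseteq> T \<Longrightarrow> refutes T F"
  by (induction F) auto

lemma refutes_member: "F \<in> S \<Longrightarrow> (\<And>A B. F \<noteq> Or A B \<and> F \<noteq> And A B) \<Longrightarrow> refutes S F"
  by (cases F) auto

text \<open>The set \<open>U\<close> is closed under the unfolding of \<open>CKd\<close> but not under that of \<open>CK\<close>, which keeps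
  it finite.\<close>

locale bounded_completeness =
  fixes U :: "('p, 'i::{finite, linorder}) form set" and \<delta> \<epsilon> :: "'a ordinal"
  assumes finite_U: "finite U"
    and U_Or: "Or A B \<in> U \<Longrightarrow> A \<in> U \<and> B \<in> U"
    and U_And: "And A B \<in> U \<Longrightarrow> A \<in> U \<and> B \<in> U"
    and U_Dia: "Dia i A \<in> U \<Longrightarrow> A \<in> U"
    and U_Box: "Box i A \<in> U \<Longrightarrow> A \<in> U"
    and U_CKd: "CKd A \<in> U \<Longrightarrow> Dia i A \<in> U"
    and U_CK: "CK A \<in> U \<Longrightarrow> A \<in> U"
    and level: "\<delta> + ord_of_nat n < \<epsilon>"
    and stagnant: "S \<subseteq> U \<Longrightarrow> (\<And>M. covers M S \<Longrightarrow> GC_derivable \<epsilon> 0 M) \<Longrightarrow> prov \<delta> S {#}"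
begin

section \<open>The canonical model of underivable saturated sets\<close>

definition world :: "('p, 'i) form set \<Rightarrow> bool" where
  "world S \<longleftrightarrow> S \<subseteq> U \<and> (\<forall>A i. CKd A \<in> S \<longrightarrow> Dia i A \<in> S) \<and> \<not> prov \<delta> S {#}"

text \<open>The box context of \<open>S\<close> is refuted by \<open>T\<close> rather than contained
  in it, since its formulas may be disjunctions or conjunctions.\<close>

definition acc :: "'i \<Rightarrow> ('p, 'i) form set \<Rightarrow> ('p, 'i) form set \<Rightarrow> bool" where
  "acc i S T \<longleftrightarrow> world S \<and> world T \<and> (\<forall>F\<in>#step i S. refutes T F)"

lemma finite_subset_U: "S \<subseteq> U \<Longrightarrow> finite S"
  using finite_U by (rule finite_subset[rotated])

lemma finite_world: "world S \<Longrightarrow> finite S"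
  by (simp add: world_def finite_subset_U)

text \<open>Propositional proof search backwards: each inference for \<open>Or\<close> or
  \<open>And\<close> decreases the total size of \<open>N\<close>. At the end no formula of
  \<open>N\<close> is a disjunction or conjunction, so \<open>set_mset N\<close> refutes
  \<open>N\<close> and the hypothesis applies to it.\<close>

lemma decompose:
  assumes "\<And>S. S \<subseteq> U \<Longrightarrow> \<forall>F\<in>#N. refutes S F \<Longrightarrow> prov \<delta> S C" "set_mset N \<subseteq> U"
  shows "\<exists>n. GC_derivable (\<delta> + ord_of_nat n) 0 (N + C)"
  using assms
proof (induction "\<Sum>\<^sub># (image_mset size N)" arbitrary: N rule: less_induct)
  case less
  consider (Or) A B where "Or A B \<in># N" | (And) A B where "And A B \<in># N"
    | (atoms) "\<forall>F\<in>#N. \<forall>A B. F \<noteq> Or A B \<and> F \<noteq> And A B" by blast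
  then show ?case
  proof cases
    case Or
    then obtain N' where N: "N = N' + {#Or A B#}" by (metis multi_member_split add_mset_add_single)
    have "\<exists>n. GC_derivable (\<delta> + ord_of_nat n) 0 ((N' + {#A, B#}) + C)"
    proof (rule less.hyps)
      show "prov \<delta> S C" if "S \<subseteq> U" "\<forall>F\<in>#N' + {#A, B#}. refutes S F" for S
        using that N by (intro less.prems(1)) auto
    qed (use less.prems(2) N U_Or[of A B] in auto)
    then obtain n where "GC_derivable (\<delta> + ord_of_nat n) 0 ((N' + C) + {#A, B#})"
      by (auto simp: ac_simps)
    from derivable_unary[OF or_inf this less_plus_Suc]
    show ?thesis using N by (intro exI[of _ "Suc n"]) (simp add: ac_simps)
  next
    case And
    then obtain N' where N: "N = N' + {#And A B#}" by (metis multi_member_split add_mset_add_single)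
    have "\<exists>n. GC_derivable (\<delta> + ord_of_nat n) 0 ((N' + {#A#}) + C)"
    proof (rule less.hyps)
      show "prov \<delta> S C" if "S \<subseteq> U" "\<forall>F\<in>#N' + {#A#}. refutes S F" for S
        using that N by (intro less.prems(1)) auto
    qed (use less.prems(2) N U_And[of A B] in auto)
    moreover have "\<exists>n. GC_derivable (\<delta> + ord_of_nat n) 0 ((N' + {#B#}) + C)"
    proof (rule less.hyps)
      show "prov \<delta> S C" if "S \<subseteq> U" "\<forall>F\<in>#N' + {#B#}. refutes S F" for S
        using that N by (intro less.prems(1)) auto
    qed (use less.prems(2) N U_And[of A B] in auto)
    ultimately obtain m n where
      "GC_derivable (\<delta> + ord_of_nat m) 0 ((N' + C) + {#A#})"
      "GC_derivable (\<delta> + ord_of_nat n) 0 ((N' + C) + {#B#})"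
      by (auto simp: ac_simps)
    then have "GC_derivable (\<delta> + ord_of_nat (max m n)) 0 ((N' + C) + {#A#})"
      "GC_derivable (\<delta> + ord_of_nat (max m n)) 0 ((N' + C) + {#B#})"
      by (auto elim!: derivable_mono intro!: plus_ord_of_nat_mono)
    from derivable_and[OF this less_plus_Suc]
    show ?thesis using N by (intro exI[of _ "Suc (max m n)"]) (simp add: ac_simps)
  next
    case atoms
    then have "prov \<delta> (set_mset N) C"
      using less.prems(2) by (intro less.prems(1) ballI refutes_member) auto
    then show ?thesis using covers_set_mset[of N] unfolding prov_def by blast
  qed
qed

lemma saturate_subset_U: "S \<subseteq> U \<Longrightarrow> saturate S \<subseteq> U"
  unfolding saturate_def using U_CKd by blast

lemma world_saturate:
  assumes "S \<subseteq> U" "\<not> prov \<delta> (saturate S) {#}"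
  shows "world (saturate S)"
proof -
  have "Dia i A \<in> saturate S" if "CKd A \<in> saturate S" for i A
    using that unfolding saturate_def by blast
  then show ?thesis using assms saturate_subset_U unfolding world_def by blast
qed

lemma subset_saturate: "S \<subseteq> saturate S"
  by (auto simp: saturate_def)

lemma exists_world:
  assumes "set_mset N \<subseteq> U" "\<And>n. \<not> GC_derivable (\<delta> + ord_of_nat n) 0 N"
  obtains S where "world S" "\<forall>F\<in>#N. refutes S F"
proof -
  obtain S where S: "S \<subseteq> U" "\<forall>F\<in>#N. refutes S F" "\<not> prov \<delta> S {#}"
    using decompose[of N "{#}"] assms by auto
  \<comment> \<open>By \<open>prov_saturate\<close>, saturation preserves underivability.\<close>
  then have "world (saturate S)"
    using prov_saturate finite_subset_U by (intro world_saturate) blast+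
  then show thesis using that S(2) refutes_mono[OF _ subset_saturate] by blast
qed

lemma step_subset_U: "world S \<Longrightarrow> set_mset (step i S) \<subseteq> U"
proof
  fix F assume S: "world S" and "F \<in># step i S"
  then have "Dia i F \<in> S \<or> (\<exists>A. F = CKd A \<and> CKd A \<in> S)" using finite_world in_step by metis
  then show "F \<in> U" using S U_Dia unfolding world_def by blast
qed

lemma exists_successor:
  assumes "world S" "A \<in> U" "\<And>n. \<not> GC_derivable (\<delta> + ord_of_nat n) 0 (step i S + {#A#})"
  obtains T where "acc i S T" "refutes T A"
proof -
  obtain T where "world T" "\<forall>F\<in>#step i S + {#A#}. refutes T F"
    using exists_world[of "step i S + {#A#}"] assms step_subset_U by auto
  then show thesis using assms(1) by (intro that[of T]) (simp_all add: acc_def)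
qed

lemma not_prov_worldD:
  "world S \<Longrightarrow> (\<And>M. covers M S \<Longrightarrow> GC_derivable (\<delta> + ord_of_nat n) 0 M) \<Longrightarrow> False"
  unfolding world_def prov_def add_0_right by blast

lemma world_Pos: "world S \<Longrightarrow> Pos p \<in> S \<Longrightarrow> Neg p \<notin> S"
  using not_prov_worldD derivable_axiom covers_member finite_world by (metis form.distinct(13,25))

text \<open>If no such \<open>T\<close> existed, the premise of the box rule would be derivable at
  level \<delta> up to a finite part, and one inference would derive every sequent covering
  \<open>S\<close>.\<close>

lemma world_Box:
  assumes "world S" "Box i A \<in> S"
  obtains T where "acc i S T" "refutes T A"
proof (rule exists_successor[OF assms(1)])
  show "A \<in> U" using assms U_Box unfolding world_def by blast
  fix n show "\<not> GC_derivable (\<delta> + ord_of_nat n) 0 (step i S + {#A#})"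
  proof
    assume *: "GC_derivable (\<delta> + ord_of_nat n) 0 (step i S + {#A#})"
    have step: "step i (S - {Box i A}) = step i S" by (simp add: step_def vimage_def)
    have fin: "finite S" using assms(1) by (rule finite_world)
    have "GC_derivable (\<delta> + ord_of_nat (Suc n)) 0 M" if M: "covers M S" for M
    proof -
      obtain M' G where M': "M = M' + {#G#}" "represents G (Box i A)" "covers M' (S - {Box i A})"
        using covers_remove[OF M fin assms(2)] by blast
      have "GC_derivable (\<delta> + ord_of_nat (Suc n)) 0 (M' + {#Box i A#})"
        by (rule derivable_box[OF M'(3) _ _ less_plus_Suc]) (use * fin step in simp_all)
      then show ?thesis using M' by (simp add: represents_def)
    qed
    then show False by (rule not_prov_worldD[OF assms(1)])
  qed
qed (use that in blast)

abbreviation reach :: "('p, 'i) form set \<Rightarrow> ('p, 'i) form set \<Rightarrow> bool" where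
  "reach \<equiv> (\<lambda>S T. \<exists>i. acc i S T)\<^sup>+\<^sup>+"

text \<open>
  If \<open>A\<close> is refuted nowhere above \<open>S\<close>, then \<open>CK A\<close> may be replaced by \<open>box_all\<^sup>k A\<close> at a
  cost that is finite for every \<open>k\<close>: each step leads to a set that is either derivable at level \<open>\<delta>\<close>,
  or a successor of \<open>S\<close> with the same property.
\<close>

lemma prov_box_all_funpow:
  assumes "world S" "CK A \<in> S" "\<And>T. reach S T \<Longrightarrow> \<not> refutes T A"
  shows "prov \<delta> (S - {CK A}) {#(box_all ^^ Suc k) A#}"
proof -
  have prov_box: "prov \<delta> (S - {CK A}) {#box_all B#}"
    if S: "world S" "CK A \<in> S"
      and B: "\<And>i. \<exists>n. GC_derivable (\<delta> + ord_of_nat n) 0 (step i S + {#B#})" for S B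
  proof -
    have "finite S" using S(1) by (rule finite_world)
    have step: "step i (S - {CK A}) = step i S" for i by (simp add: step_def vimage_def)
    from B obtain f where f: "\<And>i. GC_derivable (\<delta> + ord_of_nat (f i)) 0 (step i S + {#B#})"
      by metis
    \<comment> \<open>There are finitely many agents, so the finite parts have a maximum.\<close>
    define n where "n = Max (range f)"
    have n: "GC_derivable (\<delta> + ord_of_nat n) 0 (step i S + {#B#})" for i
      using f[of i] by (rule derivable_mono) (simp add: n_def plus_ord_of_nat_mono)
    have "GC_derivable (\<delta> + ord_of_nat (Suc n)) 0 (M + {#Box i B#})"
      if "covers M (S - {CK A})" for M i
      by (rule derivable_box[OF that _ _ less_plus_Suc]) (use n \<open>finite S\<close> step in simp_all)
    then show ?thesis unfolding prov_def using derivable_box_all by blast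
  qed
  show ?thesis
    using assms
  proof (induction k arbitrary: S)
    case 0
    have "\<exists>n. GC_derivable (\<delta> + ord_of_nat n) 0 (step i S + {#A#})" for i
    proof (rule ccontr)
      assume "\<not> ?thesis"
      moreover have "A \<in> U" using 0 U_CK unfolding world_def by blast
      ultimately obtain T where "acc i S T" "refutes T A"
        using exists_successor[OF 0(1)] by blast
      then show False using 0(3) tranclp.r_into_trancl[of "\<lambda>S T. \<exists>i. acc i S T"] by blast
    qed
    from prov_box[OF 0(1,2) this] show ?case by simp
  next
    case (Suc k)
    let ?C = "{#(box_all ^^ Suc k) A#}"
    have "\<exists>n. GC_derivable (\<delta> + ord_of_nat n) 0 (step i S + ?C)" for i
    proof (rule decompose)
      fix \<Theta> assume \<Theta>: "\<Theta> \<subseteq> U" "\<forall>F\<in>#step i S. refutes \<Theta> F"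
      \<comment> \<open>\<open>CK A\<close> is added so that the induction hypothesis, which speaks
        of worlds containing \<open>CK A\<close>, applies to \<open>?T\<close>.\<close>
      let ?T = "saturate (insert (CK A) \<Theta>)"
      have T: "insert (CK A) \<Theta> \<subseteq> U" using \<Theta> Suc.prems unfolding world_def by blast
      have "finite ?T" using saturate_subset_U[OF T] by (rule finite_subset_U)
      have "prov \<delta> (?T - {CK A}) ?C"
      proof (cases "prov \<delta> ?T {#}")
        case True
        \<comment> \<open>The formula in \<open>?C\<close> represents \<open>CK A\<close>, so the
          derivability of \<open>?T\<close> already is that of the rest with \<open>?C\<close>. This
          is the built-in inversion at work.\<close>
        have *: "covers (M + ?C) ?T" if "covers M (?T - {CK A})" for M
        proof -
          have "represents ((box_all ^^ Suc k) A) (CK A)" unfolding represents_def by blast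
          then have "covers (M + ?C) (insert (CK A) (?T - {CK A}))"
            using that \<open>finite ?T\<close> by (intro covers_insert) simp_all
          moreover have "insert (CK A) (?T - {CK A}) = ?T" using subset_saturate by blast
          ultimately show ?thesis by simp
        qed
        from True show ?thesis unfolding prov_def add_0_right using * by blast
      next
        case False
        then have "world ?T" using T world_saturate by blast
        moreover have "\<forall>F\<in>#step i S. refutes ?T F"
          using \<Theta>(2) refutes_mono[of \<Theta> _ ?T] subset_saturate[of "insert (CK A) \<Theta>"] by blast
        ultimately have "acc i S ?T" using Suc.prems(1) unfolding acc_def by blast
        then have "\<exists>i. acc i S ?T" by blast
        \<comment> \<open>What is reachable from the successor \<open>?T\<close> is reachable from
          \<open>S\<close>, so \<open>A\<close> is refuted nowhere above \<open>?T\<close>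
          either.\<close>
        from tranclp_into_tranclp2[of "\<lambda>S T. \<exists>i. acc i S T", OF this]
        have "reach S V" if "reach ?T V" for V using that by blast
        then show ?thesis
          using Suc.IH[of ?T] \<open>world ?T\<close> Suc.prems(3) subset_saturate by blast
      qed
      then obtain n where n: "\<And>M. covers M (?T - {CK A}) \<Longrightarrow>
          GC_derivable (\<delta> + ord_of_nat n) 0 (M + ?C)"
        unfolding prov_def by blast
      \<comment> \<open>The auxiliary \<open>CK A\<close> contributes nothing to saturation, so it
        can be taken out again.\<close>
      have "?T - {CK A} \<subseteq> saturate \<Theta>" by (auto simp: saturate_def)
      then have "prov \<delta> (saturate \<Theta>) ?C"
        using n covers_subset finite_subset_U[OF saturate_subset_U[OF \<Theta>(1)]]
        unfolding prov_def by blast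
      then show "prov \<delta> \<Theta> ?C" using finite_subset_U[OF \<Theta>(1)] by (rule prov_saturate)
    qed (rule step_subset_U[OF Suc.prems(1)])
    from prov_box[OF Suc.prems(1,2) this] show ?case by simp
  qed
qed

lemma world_CK:
  assumes "world S" "CK A \<in> S"
  obtains T where "reach S T" "refutes T A"
proof -
  have False if "\<And>T. reach S T \<Longrightarrow> \<not> refutes T A"
  proof -
    have fin: "finite S" using assms(1) by (rule finite_world)
    have "\<forall>k. \<exists>n. \<forall>M. covers M (S - {CK A}) \<longrightarrow>
        GC_derivable (\<delta> + ord_of_nat n) 0 (M + {#(box_all ^^ Suc k) A#})"
      using prov_box_all_funpow[OF assms that] unfolding prov_def by blast
    then obtain f where f: "\<And>k M. covers M (S - {CK A}) \<Longrightarrow>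
        GC_derivable (\<delta> + ord_of_nat (f k)) 0 (M + {#(box_all ^^ Suc k) A#})"
      by metis
    have "GC_derivable \<epsilon> 0 M" if M: "covers M S" for M
    proof -
      obtain M' G where M': "M = M' + {#G#}" "represents G (CK A)" "covers M' (S - {CK A})"
        using covers_remove[OF M fin assms(2)] by blast
      \<comment> \<open>Either the infinitary rule is applied, with premises of depths below
        \<epsilon>, or the representative is itself one of the premises.\<close>
      consider "G = CK A" | k where "G = (box_all ^^ Suc k) A"
        using M'(2) unfolding represents_def by blast
      then show ?thesis
      proof cases
        case 1
        then show ?thesis using derivable_CK[OF f[OF M'(3)] level] M' by simp
      next
        case 2
        then show ?thesis
          using derivable_mono[OF f[OF M'(3), of k] less_imp_le[OF level]] M' by simp
      qed
    qed
    \<comment> \<open>Stagnation brings derivability at \<epsilon> back to level \<delta>, where a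
      world is underivable.\<close>
    then show False using stagnant[of S] assms(1) unfolding world_def by blast
  qed
  then show thesis using that by blast
qed

text \<open>By saturation \<open>Dia i A\<close> belongs to \<open>S\<close>, so the box context
  contains \<open>A\<close> as well as \<open>CKd A\<close>.\<close>

lemma acc_CKd:
  assumes "acc i S T" "CKd A \<in> S"
  shows "world T \<and> CKd A \<in> T \<and> refutes T A"
proof -
  have "finite S" "Dia i A \<in> S" using assms finite_world by (auto simp: acc_def world_def)
  then have "A \<in># step i S" "CKd A \<in># step i S" using assms(2) by (simp_all add: in_step)
  then have "refutes T A" "refutes T (CKd A)" using assms(1) unfolding acc_def by blast+
  then show ?thesis using assms(1) unfolding acc_def by simp
qed

text \<open>The truth lemma. The valuation makes \<open>p\<close> true exactly where
  \<open>Neg p\<close> is a member, because members are to be false; \<open>world_Pos\<close> then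
  settles the case of \<open>Pos p\<close>.\<close>

lemma refutes_not_holds:
  assumes "world S" "refutes S F"
  shows "\<not> holds acc (\<lambda>p S. Neg p \<in> S) S F"
  using assms
proof (induction F arbitrary: S)
  case (Pos p)
  then show ?case using world_Pos by simp
next
  case (Dia i A)
  have "refutes T A" if "acc i S T" for T
    using that Dia.prems finite_world[of S] by (auto simp: acc_def in_step)
  then show ?case using Dia.IH unfolding acc_def by auto
next
  case (Box i A)
  then obtain T where "acc i S T" "refutes T A" using world_Box[of S i A] by auto
  then show ?case using Box.IH unfolding acc_def by auto
next
  case (CKd A)
  \<comment> \<open>The invariant includes \<open>CKd A \<in> T\<close>, so that it passes on to the
    next step of the path.\<close>
  have "world T \<and> CKd A \<in> T \<and> refutes T A" if "reach S T" for T
    using that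
  proof (induction rule: tranclp_induct)
    case (base T)
    then show ?case using CKd.prems(2) acc_CKd by auto
  next
    case (step T V)
    then show ?case using acc_CKd by blast
  qed
  then show ?case using CKd.IH by auto
next
  case (CK A)
  then obtain T where T: "reach S T" "refutes T A" using world_CK[of S A] by auto
  then have "world T" by (auto elim: tranclp.cases simp: acc_def)
  then show ?case using T CK.IH by auto
qed auto

lemma completeness:
  assumes "set_mset N \<subseteq> U" "\<And>R V w. \<exists>F\<in>#N. holds R V (w :: ('p, 'i) form set) F"
  shows "\<exists>n. GC_derivable (\<delta> + ord_of_nat n) 0 N"
proof (rule ccontr)
  assume "\<not> ?thesis"
  then obtain S where "world S" "\<forall>F\<in>#N. refutes S F" using exists_world assms(1) by blast
  then show False using assms(2) refutes_not_holds by blast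
qed

end

section \<open>Finite closure and choice of the level\<close>

primrec closure :: "('p, 'i) form \<Rightarrow> ('p, 'i) form set" where
  "closure (Pos p) = {Pos p}"
| "closure (Neg p) = {Neg p}"
| "closure (Or A B) = insert (Or A B) (closure A \<union> closure B)"
| "closure (And A B) = insert (And A B) (closure A \<union> closure B)"
| "closure (Dia i A) = insert (Dia i A) (closure A)"
| "closure (Box i A) = insert (Box i A) (closure A)"
| "closure (CKd A) = insert (CKd A) (range (\<lambda>i. Dia i A) \<union> closure A)"
| "closure (CK A) = insert (CK A) (closure A)"

lemma finite_closure: "finite (closure (F :: ('p, 'i::finite) form))"
  by (induction F) auto

lemma closure_refl: "F \<in> closure F"
  by (cases F) auto

lemma closure_trans: "G \<in> closure F \<Longrightarrow> closure G \<subseteq> closure F"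
  by (induction F) auto

text \<open>The levels are spaced by \<omega>, so a finite number of further inferences never
  reaches the next one.\<close>

lemma omega_times_less_Suc:
  "omega * ord_of_nat m + ord_of_nat n < omega * (ord_of_nat (Suc m) :: 'a ordinal)"
proof -
  have "omega * ord_of_nat m + ord_of_nat n < omega * ord_of_nat m + (omega :: 'a ordinal)"
    by (rule plus_ordinal_spec(2)) (rule ord_of_nat_less_omega)
  also have "\<dots> \<le> omega * ord_of_nat (Suc m)"
    by (intro times_ordinal_spec ord_of_nat_strict_mono) simp
  finally show ?thesis .
qed

lemma times_ordinal_mono: "0 < \<alpha> \<Longrightarrow> \<beta> \<le> \<gamma> \<Longrightarrow> \<alpha> * \<beta> \<le> \<alpha> * (\<gamma> :: 'a ordinal)"
  using times_ordinal_strict_mono[of \<alpha> \<beta> \<gamma>] by (cases "\<beta> = \<gamma>") (simp_all add: less_imp_le)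

text \<open>Each of the finitely many subsets of \<open>U\<close> that becomes derivable at some
  level \<open>omega * k\<close> does so at a least \<open>k\<close>; beyond the maximum
  \<open>m\<close> of these numbers nothing new appears.\<close>

lemma stagnant_level:
  fixes U :: "('p, 'i::{finite, linorder}) form set"
  assumes "finite U"
  obtains m where "\<And>S. S \<subseteq> U \<Longrightarrow>
      (\<And>M. covers M S \<Longrightarrow> GC_derivable (omega * (ord_of_nat (Suc m) :: 'a ordinal)) 0 M) \<Longrightarrow>
      prov (omega * (ord_of_nat m :: 'a ordinal)) S {#}"
proof -
  define P where "P k S \<longleftrightarrow>
    (\<forall>M. covers M S \<longrightarrow> GC_derivable (omega * (ord_of_nat k :: 'a ordinal)) 0 M)" for k and S :: "('p, 'i) form set"
  \<comment> \<open>For subsets that are derivable at no level the \<open>LEAST\<close> is an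
    unspecified natural number, which can only raise the maximum.\<close>
  define m where "m = Max ((\<lambda>S. LEAST k. P k S) ` Pow U)"
  have "prov (omega * (ord_of_nat m :: 'a ordinal)) S {#}" if "S \<subseteq> U" "P (Suc m) S" for S
  proof -
    have P: "P (LEAST k. P k S) S" using that(2) by (rule LeastI)
    have "(LEAST k. P k S) \<le> m" unfolding m_def using assms that(1) by (intro Max_ge) auto
    then have "ord_of_nat (LEAST k. P k S) \<le> (ord_of_nat m :: 'a ordinal)"
      using ord_of_nat_strict_mono by (metis le_less)
    then have "omega * ord_of_nat (LEAST k. P k S) \<le> omega * (ord_of_nat m :: 'a ordinal)"
      by (rule times_ordinal_mono[OF zero_less_omega])
    then have "P m S" using P derivable_mono unfolding P_def by blast
    then show ?thesis unfolding P_def prov_def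
      by (intro exI[of _ 0]) (simp add: plus_ordinal_zero)
  qed
  then show thesis using that unfolding P_def by blast
qed

text \<open>Validity is assumed for models whose worlds are sets of formulas, the type of the
  canonical model.\<close>

lemma valid_imp_derivable:
  fixes \<Gamma> :: "('p, 'i::{finite, linorder}) sequent"
  assumes "\<And>R V w. \<exists>F\<in>#\<Gamma>. holds R V (w :: ('p, 'i) form set) F"
  shows "\<exists>m. GC_derivable (omega * (ord_of_nat m :: 'a ordinal)) 0 \<Gamma>"
proof -
  let ?U = "\<Union>F\<in>set_mset \<Gamma>. closure F"
  have fin: "finite ?U" by (simp add: finite_closure)
  have sub: "closure G \<subseteq> ?U" if "G \<in> ?U" for G
    using that closure_trans by fastforce
  obtain m where m: "\<And>S. S \<subseteq> ?U \<Longrightarrow>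
      (\<And>M. covers M S \<Longrightarrow> GC_derivable (omega * (ord_of_nat (Suc m) :: 'a ordinal)) 0 M) \<Longrightarrow>
      prov (omega * (ord_of_nat m :: 'a ordinal)) S {#}"
    using stagnant_level[OF fin] by blast
  interpret bounded_completeness ?U "omega * (ord_of_nat m :: 'a ordinal)" "omega * ord_of_nat (Suc m)"
  proof
    show "finite ?U" by (rule fin)
    show "omega * ord_of_nat m + ord_of_nat n < omega * (ord_of_nat (Suc m) :: 'a ordinal)" for n
      by (rule omega_times_less_Suc)
    show "prov (omega * (ord_of_nat m :: 'a ordinal)) S {#}" if "S \<subseteq> ?U"
      "\<And>M. covers M S \<Longrightarrow> GC_derivable (omega * (ord_of_nat (Suc m) :: 'a ordinal)) 0 M" for S
      using that by (rule m)
  qed (drule sub, simp only: closure.simps insert_subset Un_subset_iff, blast intro: closure_refl)+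
  have "set_mset \<Gamma> \<subseteq> ?U" using closure_refl by fast
  from completeness[OF this assms] obtain n where
    "GC_derivable (omega * ord_of_nat m + ord_of_nat n :: 'a ordinal) 0 \<Gamma>" by blast
  then show ?thesis using derivable_mono[OF _ less_imp_le[OF omega_times_less_Suc]] by blast
qed

section \<open>Comparison with the Veblen bound\<close>

theorem theorem3p21:
  fixes n :: nat
    and \<alpha> :: "'a ordinal"
    and \<Gamma> :: "('p, 'i::{finite, linorder}) sequent"
  assumes "GC_derivable \<alpha> (omega * ord_of_nat n) \<Gamma>"
  shows "GC_derivable (omega * ((veblen 1 ^^ n) (omega * \<alpha>) + 1)) 0 \<Gamma>"
proof (cases n)
  case 0
  \<comment> \<open>The bound on cut ranks is already \<open>0\<close>, so it remains to compare
    depths.\<close>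
  have "\<alpha> \<le> omega * \<alpha>" by (rule le_times_ordinal[OF zero_less_omega])
  also have "\<dots> \<le> omega * \<alpha> + 1" by (rule plus_ordinal_spec(1))
  also have "\<dots> \<le> omega * (omega * \<alpha> + 1)" by (rule le_times_ordinal[OF zero_less_omega])
  finally show ?thesis using assms 0 by (auto simp: times_ordinal_zero intro: derivable_mono)
next
  case (Suc k)
  obtain \<pi> :: "('p, 'i) tree" where "is_proof (omega * (ord_of_nat n :: 'a ordinal)) \<pi>" "concl \<pi> = \<Gamma>"
    using assms unfolding GC_derivable_def by blast
  \<comment> \<open>Soundness retains only the validity of \<Gamma>; the new derivation is built
    independently of the depth and the cuts of \<pi>.\<close>
  then obtain m where m: "GC_derivable (omega * (ord_of_nat m :: 'a ordinal)) 0 \<Gamma>"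
    using valid_imp_derivable[of \<Gamma>] soundness by metis
  have "ord_of_nat m \<le> (omega :: 'a ordinal)" by (rule less_imp_le[OF ord_of_nat_less_omega])
  also have "\<dots> \<le> (veblen 1 ^^ n) (omega * \<alpha>)" using Suc veblen_one_ge_omega by simp
  also have "\<dots> \<le> (veblen 1 ^^ n) (omega * \<alpha>) + 1" by (rule plus_ordinal_spec(1))
  finally show ?thesis using derivable_mono[OF m] times_ordinal_mono[OF zero_less_omega] by blast
qed

end
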